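(* For every rational $\gamma\ge 2$, there exists a $\left(1.021+\frac{1}{\gamma}\right)$-consistent and $\gamma$-robust algorithm for the MST problem under explorable uncertainty with predictions.
   Context: MST problem under explorable uncertainty with predictions: a connected (multi)graph $G=(V,E)$; each edge $e$ has unknown true weight $w_e\in\mathbb{R}_+$ and known uncertainty interval $I_e$, either open $(L_e,U_e)\ni w_e$ or trivial $\{w_e\}$. Querying $e$ reveals $w_e$. $Q\subseteq E$ is a feasible query set if some spanning tree is a minimum spanning tree for every weight assignment equal to $w_e$ on $Q$ and arbitrary in $I_e$ outside $Q$; $\mathrm{OPT}$ is a minimum-cardinality feasible query set. The algorithm queries adaptively until its query set $\mathrm{ALG}$ is feasible and receives predictions $\hat w_e\in I_e$. $\alpha$-consistent: $|\mathrm{ALG}|\le\alpha|\mathrm{OPT}|$ (in expectation, for randomized algorithms) on all instances with all predictions correct; $\beta$-robust: $|\mathrm{ALG}|\le\beta|\mathrm{OPT}|$ (in expectation) on all instances regardless of predictions. *)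

theory Defs
  imports "HOL-Probability.Probability_Mass_Function"
begin

text \<open>
  Undirected multigraphs: edges are named objects, so parallel edges are distinct
  elements of \<open>edges\<close>; loops are allowed (one end).
\<close>

record ('v, 'e) mgraph =
  verts :: "'v set"
  edges :: "'e set"
  ends :: "'e \<Rightarrow> 'v set"

definition multigraph :: "('v, 'e) mgraph \<Rightarrow> bool" where
  "multigraph G \<longleftrightarrow> finite (verts G) \<and> finite (edges G) \<and>
     (\<forall>e \<in> edges G. ends G e \<subseteq> verts G \<and> card (ends G e) \<in> {1, 2})"

definition connects :: "('v, 'e) mgraph \<Rightarrow> 'e set \<Rightarrow> bool" where
  "connects G T \<longleftrightarrow> verts G \<noteq> {} \<and>
     (\<forall>u \<in> verts G. \<forall>v \<in> verts G. (u, v) \<in> {(x, y). \<exists>e \<in> T. ends G e = {x, y}}\<^sup>*)"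

text \<open>
  A cycle visits distinct vertices along distinct edges; length 1 is a loop and
  length 2 a pair of parallel edges.
\<close>

definition contains_cycle :: "('v, 'e) mgraph \<Rightarrow> 'e set \<Rightarrow> bool" where
  "contains_cycle G T \<longleftrightarrow>
     (\<exists>vs es. es \<noteq> [] \<and> length vs = length es \<and> distinct vs \<and> distinct es \<and> set es \<subseteq> T \<and>
        (\<forall>i < length es. ends G (es ! i) = {vs ! i, vs ! (Suc i mod length es)}))"

definition spanning_tree :: "('v, 'e) mgraph \<Rightarrow> 'e set \<Rightarrow> bool" where
  "spanning_tree G T \<longleftrightarrow> T \<subseteq> edges G \<and> connects G T \<and> \<not> contains_cycle G T"

definition minimum_spanning_tree :: "('v, 'e) mgraph \<Rightarrow> ('e \<Rightarrow> real) \<Rightarrow> 'e set \<Rightarrow> bool" where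
  "minimum_spanning_tree G w T \<longleftrightarrow> spanning_tree G T \<and>
     (\<forall>T'. spanning_tree G T' \<longrightarrow> sum w T \<le> sum w T')"

text \<open>
  Everything an algorithm knows before its first query. The true weights \<open>w\<close> are not part
  of the input.
\<close>

record ('v, 'e) mst_input =
  graph :: "('v, 'e) mgraph"
  uncertainty :: "'e \<Rightarrow> real set"
  prediction :: "'e \<Rightarrow> real"

definition mst_instance :: "('v, 'e) mst_input \<Rightarrow> ('e \<Rightarrow> real) \<Rightarrow> bool" where
  "mst_instance X w \<longleftrightarrow>
     multigraph (graph X) \<and> connects (graph X) (edges (graph X)) \<and>
     (\<forall>e \<in> edges (graph X).
        0 \<le> w e \<and> w e \<in> uncertainty X e \<and> prediction X e \<in> uncertainty X e \<and>
        (uncertainty X e = {w e} \<or> (\<exists>L U. uncertainty X e = {L<..<U})))"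

definition feasible_query_set :: "('v, 'e) mst_input \<Rightarrow> ('e \<Rightarrow> real) \<Rightarrow> 'e set \<Rightarrow> bool" where
  "feasible_query_set X w Q \<longleftrightarrow> Q \<subseteq> edges (graph X) \<and>
     (\<exists>T. spanning_tree (graph X) T \<and>
        (\<forall>w'. (\<forall>e \<in> Q. w' e = w e) \<and> (\<forall>e \<in> edges (graph X) - Q. w' e \<in> uncertainty X e)
           \<longrightarrow> minimum_spanning_tree (graph X) w' T))"

definition opt_card :: "('v, 'e) mst_input \<Rightarrow> ('e \<Rightarrow> real) \<Rightarrow> nat" where
  "opt_card X w = (LEAST n. \<exists>Q. feasible_query_set X w Q \<and> card Q = n)"

text \<open>
  A deterministic adaptive strategy maps the queries made so far, in order and with the
  revealed weights, to the next edge to query, or to \<open>None\<close> to stop. A (randomized) algorithm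
  turns the input into a probability distribution over such strategies; deterministic
  algorithms are those returning point masses.
\<close>

type_synonym 'e strategy = "('e \<times> real) list \<Rightarrow> 'e option"

type_synonym ('v, 'e) algorithm = "('v, 'e) mst_input \<Rightarrow> 'e strategy pmf"

text \<open>
  Asking for a non-edge or for an already queried edge counts as stopping.
  Hence a run is over after at most as many steps as there are edges.
\<close>

definition query_step ::
    "'e set \<Rightarrow> ('e \<Rightarrow> real) \<Rightarrow> 'e strategy \<Rightarrow> ('e \<times> real) list \<Rightarrow> ('e \<times> real) list" where
  "query_step E w s h = (case s h of
       None \<Rightarrow> h
     | Some e \<Rightarrow> if e \<in> E - fst ` set h then h @ [(e, w e)] else h)"

definition queries :: "('v, 'e) mst_input \<Rightarrow> ('e \<Rightarrow> real) \<Rightarrow> 'e strategy \<Rightarrow> 'e set" where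
  "queries X w s =
     fst ` set ((query_step (edges (graph X)) w s ^^ card (edges (graph X))) [])"

definition solves_mst :: "('v, 'e) algorithm \<Rightarrow> bool" where
  "solves_mst A \<longleftrightarrow> (\<forall>X w. mst_instance X w \<longrightarrow>
     (\<forall>s \<in> set_pmf (A X). feasible_query_set X w (queries X w s)))"

definition expected_queries :: "('v, 'e) algorithm \<Rightarrow> ('v, 'e) mst_input \<Rightarrow> ('e \<Rightarrow> real) \<Rightarrow> real" where
  "expected_queries A X w = measure_pmf.expectation (A X) (\<lambda>s. real (card (queries X w s)))"

definition consistent :: "real \<Rightarrow> ('v, 'e) algorithm \<Rightarrow> bool" where
  "consistent \<alpha> A \<longleftrightarrow> (\<forall>X w. mst_instance X w \<and> (\<forall>e \<in> edges (graph X). prediction X e = w e) \<longrightarrow>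
     expected_queries A X w \<le> \<alpha> * real (opt_card X w))"

definition robust :: "real \<Rightarrow> ('v, 'e) algorithm \<Rightarrow> bool" where
  "robust \<beta> A \<longleftrightarrow> (\<forall>X w. mst_instance X w \<longrightarrow>
     expected_queries A X w \<le> \<beta> * real (opt_card X w))"

end

theory Submission
  imports Defs
begin

text \<open>
  For integer \<open>g \<ge> 2\<close> there is a deterministic strategy that is \<open>(1 + 1/g)\<close>-consistent and
  \<open>g\<close>-robust; for other \<open>\<gamma>\<close> one mixes the strategies for the two neighbouring integers, which
  costs at most \<open>1/48 < 0.021\<close> in consistency.

  Consistency and robustness only distinguish correct predictions from arbitrary ones, so the
  strategy can follow a query sequence computed in advance from the predictions and give it up at
  the first wrong answer. It then completes a set \<open>W\<close> of which every feasible query set contains at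
  least the fraction \<open>1/g\<close>, and goes on with the prediction-free \<open>2\<close>-competitive method
  of querying both elements of witness pairs.

  To compute the sequence, suppose that no query is known to be mandatory. Then one spanning tree
  is minimum for the lower and for the upper limits. Let \<open>e\<close> be a tree edge on the fundamental
  cycle of \<open>f\<close> such that the two intervals overlap. If \<open>e\<close> has the largest upper limit on this
  cycle, then \<open>{e, f}\<close> is a witness pair, and \<open>e\<close> is mandatory if \<open>w f\<close> lies below the upper
  limit of \<open>e\<close>; dually for \<open>f\<close> with the smallest lower limit across the cut of \<open>e\<close>.
  Elements that are mandatory according to the prediction of their partner are queried, and the
  partner is queried as well only when it would be charged by \<open>g\<close> of them. Once no
  predicted mandatory elements are left, a minimum vertex cover of the overlap graph is queried,
  whose elements are matched to witness partners by Koenig's theorem.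
\<close>

subsection \<open>Symmetric exchange of spanning trees\<close>

definition joined :: "('v, 'e) mgraph \<Rightarrow> 'e set \<Rightarrow> ('v \<times> 'v) set" where
  "joined G S = {(x, y). \<exists>e \<in> S. ends G e = {x, y}}\<^sup>*"

lemma connects_iff_joined:
  "connects G T \<longleftrightarrow> verts G \<noteq> {} \<and> (\<forall>u \<in> verts G. \<forall>v \<in> verts G. (u, v) \<in> joined G T)"
  by (simp add: connects_def joined_def)

lemma joined_refl [simp]: "(x, x) \<in> joined G S"
  by (simp add: joined_def)

lemma joined_trans: "(x, y) \<in> joined G S \<Longrightarrow> (y, z) \<in> joined G S \<Longrightarrow> (x, z) \<in> joined G S"
  by (auto simp: joined_def)

lemma joined_sym: "(x, y) \<in> joined G S \<Longrightarrow> (y, x) \<in> joined G S"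
proof -
  have "sym {(x, y). \<exists>e \<in> S. ends G e = {x, y}}"
    by (auto simp: sym_def insert_commute)
  then show "(x, y) \<in> joined G S \<Longrightarrow> (y, x) \<in> joined G S"
    unfolding joined_def by (meson sym_rtrancl symD)
qed

lemma joined_mono: "(x, y) \<in> joined G S \<Longrightarrow> S \<subseteq> S' \<Longrightarrow> (x, y) \<in> joined G S'"
  unfolding joined_def by (erule rtrancl_mono[THEN subsetD, rotated]) auto

lemma joined_edge: "e \<in> S \<Longrightarrow> ends G e = {x, y} \<Longrightarrow> (x, y) \<in> joined G S"
  unfolding joined_def by (rule r_into_rtrancl) auto

text \<open>A walk needs \<open>g\<close> at most once. If it traverses \<open>g\<close> again in
  the same direction, the detour in between is cut out; if in the opposite direction, it is back at
  the vertex from which it first used \<open>g\<close>, and \<open>g\<close> is avoided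
  altogether.\<close>

lemma joined_insert:
  assumes "(a, b) \<in> joined G (insert g S)"
  shows "(a, b) \<in> joined G S \<or>
    (\<exists>x y. ends G g = {x, y} \<and> (a, x) \<in> joined G S \<and> (y, b) \<in> joined G S)"
  using assms[unfolded joined_def]
proof (induction rule: rtrancl_induct)
  case base
  then show ?case by simp
next
  case (step y z)
  then obtain e where e: "e \<in> insert g S" "ends G e = {y, z}" by auto
  show ?case
  proof (cases "e \<in> S")
    case True
    then show ?thesis using step.IH joined_edge[OF True e(2)] by (meson joined_trans)
  next
    case False
    then have g: "ends G g = {y, z}" using e by auto
    from step.IH show ?thesis
    proof
      assume "(a, y) \<in> joined G S"
      then show ?thesis using g by (metis joined_refl)
    next
      assume "\<exists>x y'. ends G g = {x, y'} \<and> (a, x) \<in> joined G S \<and> (y', y) \<in> joined G S"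
      then obtain x y' where x: "ends G g = {x, y'}" "(a, x) \<in> joined G S" "(y', y) \<in> joined G S"
        by blast
      have "x = y \<and> y' = z \<or> x = z \<and> y' = y" using x(1) g by (metis doubleton_eq_iff)
      then show ?thesis using x by (metis joined_refl)
    qed
  qed
qed

lemma joined_crossing:
  assumes "(a, b) \<in> joined G S" "a \<in> A" "b \<notin> A"
  obtains g x y where "g \<in> S" "ends G g = {x, y}" "x \<in> A" "y \<notin> A"
proof -
  have "b \<in> A \<or> (\<exists>g\<in>S. \<exists>x y. ends G g = {x, y} \<and> x \<in> A \<and> y \<notin> A)"
    using assms(1)[unfolded joined_def]
  proof (induction rule: rtrancl_induct)
    case base then show ?case using assms by simp
  next
    case (step y z) then show ?case by auto
  qed
  then show thesis using assms(3) that by blast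
qed

text \<open>
  Spanning trees are the minimal connecting edge sets; this description is stable under
  exchanges and avoids explicit cycles.
\<close>

definition minimal_connecting :: "('v, 'e) mgraph \<Rightarrow> 'e set \<Rightarrow> bool" where
  "minimal_connecting G T \<longleftrightarrow> T \<subseteq> edges G \<and> connects G T \<and> (\<forall>e \<in> T. \<not> connects G (T - {e}))"

text \<open>The path is extended edge by edge; when it returns to a vertex already visited, it is
  cut back to that visit.\<close>

lemma simple_path:
  assumes "(a, b) \<in> joined G S"
  shows "\<exists>vs es. length vs = Suc (length es) \<and> distinct vs \<and> set es \<subseteq> S \<and> hd vs = a \<and>
    last vs = b \<and> (\<forall>i < length es. ends G (es ! i) = {vs ! i, vs ! Suc i})"
  using assms[unfolded joined_def]
proof (induction rule: rtrancl_induct)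
  case base
  then show ?case by (intro exI[of _ "[a]"] exI[of _ "[]"]) auto
next
  case (step y z)
  then obtain vs es where p: "length vs = Suc (length es)" "distinct vs" "set es \<subseteq> S" "hd vs = a"
    "last vs = y" "\<forall>i < length es. ends G (es ! i) = {vs ! i, vs ! Suc i}" by blast
  from step obtain e where e: "e \<in> S" "ends G e = {y, z}" by auto
  have ne: "vs \<noteq> []" using p by auto
  show ?case
  proof (cases "z \<in> set vs")
    case True
    then obtain k where k: "k < length vs" "vs ! k = z" by (auto simp: in_set_conv_nth)
    show ?thesis
    proof (intro exI conjI)
      show "length (take (Suc k) vs) = Suc (length (take k es))" using k p by simp
      show "distinct (take (Suc k) vs)" using p by simp
      show "set (take k es) \<subseteq> S" using p(3) by (meson set_take_subset subset_trans)
      show "hd (take (Suc k) vs) = a" using p(4) by (simp add: take_Suc ne)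
      show "last (take (Suc k) vs) = z" using k by (simp add: take_Suc_conv_app_nth)
      show "\<forall>i < length (take k es). ends G (take k es ! i) =
          {take (Suc k) vs ! i, take (Suc k) vs ! Suc i}" using p(6) by simp
    qed
  next
    case False
    show ?thesis
    proof (intro exI conjI)
      show "length (vs @ [z]) = Suc (length (es @ [e]))" using p by simp
      show "distinct (vs @ [z])" using False p by simp
      show "set (es @ [e]) \<subseteq> S" using p e by simp
      show "hd (vs @ [z]) = a" using p ne by simp
      show "last (vs @ [z]) = z" by simp
      show "\<forall>i < length (es @ [e]). ends G ((es @ [e]) ! i) = {(vs @ [z]) ! i, (vs @ [z]) ! Suc i}"
      proof (intro allI impI)
        fix i assume "i < length (es @ [e])"
        then consider "i < length es" | "i = length es" by fastforce
        then show "ends G ((es @ [e]) ! i) = {(vs @ [z]) ! i, (vs @ [z]) ! Suc i}"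
        proof cases
          case 1 then show ?thesis using p by (simp add: nth_append)
        next
          case 2
          have "vs ! length es = y" using p(1,5) ne by (simp add: last_conv_nth)
          then show ?thesis using 2 p(1) e(2) by (simp add: nth_append)
        qed
      qed
    qed
  qed
qed

lemma redundant_edge_iff:
  assumes "connects G T" "e \<in> T" "ends G e = {a, b}" "a \<in> verts G" "b \<in> verts G"
  shows "connects G (T - {e}) \<longleftrightarrow> (a, b) \<in> joined G (T - {e})"
proof
  assume "connects G (T - {e})"
  then show "(a, b) \<in> joined G (T - {e})" using assms by (auto simp: connects_iff_joined)
next
  assume ab: "(a, b) \<in> joined G (T - {e})"
  have "(u, v) \<in> joined G (T - {e})" if "u \<in> verts G" "v \<in> verts G" for u v
  proof -
    have "(u, v) \<in> joined G (insert e (T - {e}))"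
      using assms(1,2) that by (simp add: connects_iff_joined insert_absorb)
    from joined_insert[OF this] show ?thesis
    proof
      assume "\<exists>x y. ends G e = {x, y} \<and> (u, x) \<in> joined G (T - {e}) \<and> (y, v) \<in> joined G (T - {e})"
      then obtain x y where x: "ends G e = {x, y}" "(u, x) \<in> joined G (T - {e})"
        "(y, v) \<in> joined G (T - {e})" by blast
      have "(x, y) \<in> joined G (T - {e})"
        using x(1) assms(3) ab joined_sym[OF ab] by (auto simp: doubleton_eq_iff)
      then show ?thesis using x by (meson joined_trans)
    qed
  qed
  then show "connects G (T - {e})" using assms(1) by (simp add: connects_iff_joined)
qed

lemma edge_endsE:
  assumes "multigraph G" "e \<in> edges G"
  obtains a b where "ends G e = {a, b}" "a \<in> verts G" "b \<in> verts G"
proof -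
  have "ends G e \<subseteq> verts G" "card (ends G e) = 1 \<or> card (ends G e) = 2"
    using assms by (auto simp: multigraph_def)
  then show thesis using that
    by (metis card_1_singletonE card_2_iff insert_absorb2 insert_subset)
qed

text \<open>A simple path around \<open>e\<close> closed by \<open>e\<close> is a cycle; for a loop
  the path is a single vertex.\<close>

lemma contains_cycle_if_redundant:
  assumes "multigraph G" "T \<subseteq> edges G" "e \<in> T" "connects G (T - {e})"
  shows "contains_cycle G T"
proof -
  obtain a b where ab: "ends G e = {a, b}" "a \<in> verts G" "b \<in> verts G"
    using edge_endsE assms by (metis subsetD)
  have "(a, b) \<in> joined G (T - {e})" using ab assms by (auto simp: connects_iff_joined)
  from simple_path[OF this] obtain vs es where p: "length vs = Suc (length es)" "distinct vs"
    "set es \<subseteq> T - {e}" "hd vs = a" "last vs = b"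
    "\<And>i. i < length es \<Longrightarrow> ends G (es ! i) = {vs ! i, vs ! Suc i}" by blast
  have ne: "vs \<noteq> []" using p by auto
  \<comment> \<open>Equal edges would have equal end pairs, which distinct vertices allow only at
    equal positions.\<close>
  have "distinct es"
    unfolding distinct_conv_nth
  proof (intro allI impI)
    fix i j assume ij: "i < length es" "j < length es" "i \<noteq> j"
    show "es ! i \<noteq> es ! j"
    proof
      assume "es ! i = es ! j"
      then have "{vs ! i, vs ! Suc i} = {vs ! j, vs ! Suc j}" using p(6) ij by metis
      then have "i = j \<or> (i = Suc j \<and> Suc i = j)"
        using ij p(1) nth_eq_iff_index_eq[OF p(2)]
        by (auto simp: doubleton_eq_iff)
      then show False using ij by auto
    qed
  qed
  then show ?thesis
    unfolding contains_cycle_def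
  proof (intro exI[of _ vs] exI[of _ "es @ [e]"] conjI)
    show "\<forall>i < length (es @ [e]). ends G ((es @ [e]) ! i) =
        {vs ! i, vs ! (Suc i mod length (es @ [e]))}"
    proof (intro allI impI)
      fix i assume "i < length (es @ [e])"
      then consider "i < length es" | "i = length es" by fastforce
      then show "ends G ((es @ [e]) ! i) = {vs ! i, vs ! (Suc i mod length (es @ [e]))}"
      proof cases
        case 1 then show ?thesis using p(6) by (simp add: nth_append)
      next
        case 2
        have "vs ! length es = b" "vs ! 0 = a"
          using p(1,4,5) ne by (simp_all add: last_conv_nth hd_conv_nth)
        then show ?thesis using 2 ab(1) by (simp add: nth_append insert_commute)
      qed
    qed
  qed (use p assms in auto)
qed

text \<open>The last edge of the cycle can go, since the other edges still link its ends.\<close>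

lemma redundant_if_contains_cycle:
  assumes "multigraph G" "T \<subseteq> edges G" "connects G T" "contains_cycle G T"
  shows "\<exists>e \<in> T. connects G (T - {e})"
proof -
  obtain vs es where c: "es \<noteq> []" "length vs = length es" "distinct vs" "distinct es" "set es \<subseteq> T"
    "\<And>i. i < length es \<Longrightarrow> ends G (es ! i) = {vs ! i, vs ! (Suc i mod length es)}"
    using assms(4) unfolding contains_cycle_def by blast
  define n where "n = length es - 1"
  have n: "length es = Suc n" using c(1) by (simp add: n_def)
  define e where "e = es ! n"
  have e: "e \<in> T" "ends G e = {vs ! n, vs ! 0}" using c(6)[of n] n c(5) by (auto simp: e_def)
  have path: "i \<le> n \<Longrightarrow> (vs ! 0, vs ! i) \<in> joined G (T - {e})" for i
  proof (induction i)
    case (Suc i)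
    have "es ! i \<noteq> e" using Suc.prems n c(4) by (auto simp: e_def nth_eq_iff_index_eq)
    moreover have "es ! i \<in> T" using c(5) n Suc.prems nth_mem[of i es] by auto
    moreover have "ends G (es ! i) = {vs ! i, vs ! Suc i}" using c(6)[of i] n Suc.prems by simp
    ultimately have "(vs ! i, vs ! Suc i) \<in> joined G (T - {e})" by (intro joined_edge) auto
    then show ?case using Suc by (meson Suc_leD joined_trans)
  qed simp
  have "ends G e \<subseteq> verts G" using assms e(1) by (auto simp: multigraph_def)
  then show ?thesis
    using redundant_edge_iff[OF assms(3) e] e joined_sym[OF path[of n]] by (auto intro: bexI[of _ e])
qed

lemma spanning_tree_iff_minimal_connecting:
  assumes "multigraph G"
  shows "spanning_tree G T \<longleftrightarrow> minimal_connecting G T"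
proof
  assume T: "spanning_tree G T"
  then have "\<not> connects G (T - {e})" if "e \<in> T" for e
    using contains_cycle_if_redundant[OF assms _ that] by (auto simp: spanning_tree_def)
  with T show "minimal_connecting G T" by (simp add: spanning_tree_def minimal_connecting_def)
next
  assume T: "minimal_connecting G T"
  then have "\<not> contains_cycle G T"
    using redundant_if_contains_cycle[OF assms] by (auto simp: minimal_connecting_def)
  with T show "spanning_tree G T" by (simp add: spanning_tree_def minimal_connecting_def)
qed

text \<open>Deleting \<open>e\<close> leaves two sides, and \<open>g\<close> bridges them. If a
  further \<open>h\<close> were redundant in the new set, each side would stay connected without
  \<open>h\<close>; putting \<open>e\<close> back in place of \<open>g\<close> would then make
  \<open>T - {h}\<close> connecting, against minimality.\<close>

lemma minimal_connecting_exchange: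
  assumes G: "multigraph G" and T: "minimal_connecting G T" and e: "e \<in> T" "ends G e = {a, b}"
    and g: "g \<in> edges G" "ends G g = {x, y}" and gT: "g \<notin> T"
    and ax: "(a, x) \<in> joined G (T - {e})" and yb: "(y, b) \<in> joined G (T - {e})"
  shows "minimal_connecting G (insert g (T - {e}))"
proof -
  have conn: "connects G T" and TE: "T \<subseteq> edges G"
    using T by (auto simp: minimal_connecting_def)
  have V: "a \<in> verts G" "b \<in> verts G" "x \<in> verts G" "y \<in> verts G"
  proof -
    have "ends G e \<subseteq> verts G" "ends G g \<subseteq> verts G"
      using G TE e(1) g(1) by (auto simp: multigraph_def)
    then show "a \<in> verts G" "b \<in> verts G" "x \<in> verts G" "y \<in> verts G"
      using e(2) g(2) by auto
  qed
  have nab: "(a, b) \<notin> joined G (T - {e})"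
    using T e redundant_edge_iff[OF conn e V(1,2)] by (auto simp: minimal_connecting_def)
  have "(a, b) \<in> joined G (insert g (T - {e}))"
    using joined_mono[OF ax, of "insert g (T - {e})"] joined_mono[OF yb, of "insert g (T - {e})"]
      joined_edge[OF insertI1 g(2)] by (meson joined_trans subset_insertI)
  moreover have "connects G (insert g T)"
    using conn by (auto simp: connects_iff_joined intro: joined_mono)
  moreover have "g \<noteq> e" using e(1) gT by blast
  then have "insert g T - {e} = insert g (T - {e})" by auto
  ultimately have conn': "connects G (insert g (T - {e}))"
    using redundant_edge_iff[of G "insert g T" e a b] e V by (metis insertCI)
  moreover have "\<not> connects G (insert g (T - {e}) - {h})" if h: "h \<in> insert g (T - {e})" for h
  proof
    assume c: "connects G (insert g (T - {e}) - {h})"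
    show False
    proof (cases "h = g")
      case True
      then have "insert g (T - {e}) - {h} \<subseteq> T - {e}" by auto
      then have "connects G (T - {e})" using c by (auto simp: connects_iff_joined intro: joined_mono)
      then show False using T e by (auto simp: minimal_connecting_def)
    next
      case False
      define N where "N = T - {e} - {h}"
      have N: "insert g (T - {e}) - {h} = insert g N" using False by (auto simp: N_def)
      have hT: "h \<in> T" "h \<noteq> e" using h False by auto
      have sub: "(p, q) \<in> joined G N \<Longrightarrow> (p, q) \<in> joined G (T - {e})" for p q
        by (erule joined_mono) (auto simp: N_def)
      \<comment> \<open>Every vertex is linked within \<open>N\<close> to one end of
        \<open>g\<close>, so there are at most two components, one around \<open>x\<close> and one
        around \<open>y\<close>.\<close>
      have reach: "(v, x) \<in> joined G N \<or> (v, y) \<in> joined G N" if v: "v \<in> verts G" for v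
      proof -
        have "(v, x) \<in> joined G (insert g N)" using c N v V by (auto simp: connects_iff_joined)
        from joined_insert[OF this] show ?thesis using g(2) by (auto simp: doubleton_eq_iff)
      qed
      have "(a, y) \<notin> joined G N" using nab yb sub by (meson joined_trans)
      then have aN: "(a, x) \<in> joined G N" using reach V by blast
      have "(b, x) \<notin> joined G N" using nab ax sub by (meson joined_trans joined_sym)
      then have bN: "(b, y) \<in> joined G N" using reach V by blast
      have ins: "(p, q) \<in> joined G N \<Longrightarrow> (p, q) \<in> joined G (T - {h})" for p q
        by (erule joined_mono) (auto simp: N_def)
      have ab: "(a, b) \<in> joined G (T - {h})" using e hT by (intro joined_edge[of e]) auto
      have xa: "(v, a) \<in> joined G (T - {h})" if "v \<in> verts G" for v
        using reach[OF that] ins aN bN ab by (meson joined_trans joined_sym)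
      have "connects G (T - {h})"
        unfolding connects_iff_joined
      proof (intro conjI ballI)
        show "verts G \<noteq> {}" using conn by (simp add: connects_iff_joined)
        fix u v assume "u \<in> verts G" "v \<in> verts G"
        then show "(u, v) \<in> joined G (T - {h})"
          using joined_trans[OF xa joined_sym[OF xa]] by blast
      qed
      then show False using T hT by (auto simp: minimal_connecting_def)
    qed
  qed
  ultimately show ?thesis using TE g by (auto simp: minimal_connecting_def)
qed

text \<open>\<open>A\<close> is the side of \<open>a\<close> after deleting \<open>e\<close> from
  \<open>S\<close>, and \<open>P\<close> is a minimal part of \<open>T\<close> joining the ends of
  \<open>e\<close>, that is, the rest of the fundamental cycle of \<open>e\<close> in
  \<open>T\<close>. An edge \<open>g\<close> at which \<open>P\<close> leaves \<open>A\<close>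
  serves both exchanges, as it lies in the cut and on the cycle.\<close>

lemma spanning_tree_symmetric_exchange:
  assumes G: "multigraph G" and T: "spanning_tree G S" "spanning_tree G T" and e: "e \<in> S - T"
  shows "\<exists>g \<in> T - S. spanning_tree G (insert g (S - {e})) \<and> spanning_tree G (insert e (T - {g}))"
proof -
  note st = spanning_tree_iff_minimal_connecting[OF G]
  have S': "minimal_connecting G S" and T': "minimal_connecting G T" using T st by auto
  then have SE: "S \<subseteq> edges G" "T \<subseteq> edges G" "connects G S" "connects G T"
    by (auto simp: minimal_connecting_def)
  obtain a b where ab: "ends G e = {a, b}" "a \<in> verts G" "b \<in> verts G"
    using edge_endsE[OF G] e SE by blast
  have nab: "(a, b) \<notin> joined G (S - {e})"
    using S' e redundant_edge_iff[OF SE(3) _ ab] by (auto simp: minimal_connecting_def)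
  define A where "A = {v. (a, v) \<in> joined G (S - {e})}"
  have "finite T" using SE G finite_subset by (auto simp: multigraph_def)
  moreover have "(a, b) \<in> joined G T" using SE ab by (auto simp: connects_iff_joined)
  ultimately have "finite {P. P \<subseteq> T \<and> (a, b) \<in> joined G P}"
    "T \<in> {P. P \<subseteq> T \<and> (a, b) \<in> joined G P}" by auto
  from finite_has_minimal2[OF this] obtain P where
    P0: "P \<in> {P. P \<subseteq> T \<and> (a, b) \<in> joined G P}"
    "\<forall>P' \<in> {P. P \<subseteq> T \<and> (a, b) \<in> joined G P}. P' \<subseteq> P \<longrightarrow> P = P'" by blast
  then have P: "P \<subseteq> T" "(a, b) \<in> joined G P" by auto
  have Pmin: "(a, b) \<notin> joined G P'" if "P' \<subset> P" for P'
  proof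
    assume "(a, b) \<in> joined G P'"
    then have "P = P'" using P0(2) that P(1) by auto
    then show False using that by simp
  qed
  obtain g x0 y0 where g: "g \<in> P" "ends G g = {x0, y0}" "x0 \<in> A" "y0 \<notin> A"
    using joined_crossing[OF P(2), of A] nab by (auto simp: A_def)
  have gT: "g \<in> T" "g \<in> edges G" using g P SE by auto
  have gS: "g \<notin> S"
  proof
    assume "g \<in> S"
    then have "g \<in> S - {e}" using e gT by auto
    then have "(x0, y0) \<in> joined G (S - {e})" using g by (intro joined_edge)
    then show False using g by (auto simp: A_def intro: joined_trans)
  qed
  have y0b: "(y0, b) \<in> joined G (S - {e})"
  proof -
    have "y0 \<in> verts G" using G gT g by (auto simp: multigraph_def)
    then have "(a, y0) \<in> joined G (insert e (S - {e}))"
      using SE ab e by (auto simp: connects_iff_joined insert_absorb)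
    from joined_insert[OF this] show ?thesis
      using g ab by (auto simp: A_def doubleton_eq_iff intro: joined_sym)
  qed
  have "minimal_connecting G (insert g (S - {e}))"
    using minimal_connecting_exchange[OF G S' _ ab(1) gT(2) g(2) gS _ y0b] e g by (auto simp: A_def)
  \<comment> \<open>By minimality of \<open>P\<close>, the edge \<open>g\<close> cannot be bypassed
    within \<open>P\<close>, so the rest of \<open>P\<close> links \<open>a\<close> and
    \<open>b\<close> to the two ends of \<open>g\<close>.\<close>
  moreover have "minimal_connecting G (insert e (T - {g}))"
  proof -
    have "(a, b) \<notin> joined G (P - {g})" using g by (intro Pmin) auto
    moreover have "(a, b) \<in> joined G (insert g (P - {g}))" using P g by (simp add: insert_absorb)
    ultimately obtain x y where xy: "ends G g = {x, y}" "(a, x) \<in> joined G (P - {g})"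
      "(y, b) \<in> joined G (P - {g})" using joined_insert by metis
    have sub: "(p, q) \<in> joined G (P - {g}) \<Longrightarrow> (p, q) \<in> joined G (T - {g})" for p q
      by (erule joined_mono) (use P in auto)
    show ?thesis
      using minimal_connecting_exchange[OF G T' gT(1) xy(1) _ ab(1) _ joined_sym[OF sub[OF xy(2)]]
          joined_sym[OF sub[OF xy(3)]]] e SE by blast
  qed
  ultimately show ?thesis using st gS gT by auto
qed

lemma ex_spanning_tree:
  assumes G: "multigraph G" and c: "connects G (edges G)"
  shows "\<exists>T. spanning_tree G T"
proof -
  define F where "F = {T. T \<subseteq> edges G \<and> connects G T}"
  have "finite F" using G by (simp add: F_def multigraph_def)
  moreover have "edges G \<in> F" using c by (simp add: F_def)
  ultimately obtain T where T: "T \<in> F" "\<forall>T' \<in> F. T' \<subseteq> T \<longrightarrow> T = T'"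
    using finite_has_minimal2[of F "edges G"] by metis
  have "\<not> connects G (T - {e})" if "e \<in> T" for e
  proof
    assume "connects G (T - {e})"
    then have "T - {e} \<in> F" using T(1) by (auto simp: F_def)
    then have "T = T - {e}" using T(2) by blast
    then show False using that by blast
  qed
  then have "minimal_connecting G T" using T(1) by (simp add: minimal_connecting_def F_def)
  then show ?thesis using spanning_tree_iff_minimal_connecting[OF G] by blast
qed

subsection \<open>Mandatory elements and witness pairs\<close>

text \<open>Equal limits stand for a trivial interval and other limits for an open one, so two reals
  describe both kinds.\<close>

definition in_range :: "real \<Rightarrow> real \<Rightarrow> real \<Rightarrow> bool" where
  "in_range l u x \<longleftrightarrow> (l = u \<and> x = l) \<or> (l < x \<and> x < u)"

lemma in_range_bounds: "in_range l u x \<Longrightarrow> l \<le> x \<and> x \<le> u"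
  by (auto simp: in_range_def)

text \<open>These are the bases of a matroid, given by symmetric exchange. The analysis of queries
  rests on this property alone, so fundamental cycles and cuts appear as conditions
  \<open>insert f (T - {e}) \<in> B\<close>.\<close>

locale exchange_system =
  fixes E :: "'e set" and B :: "'e set set"
  assumes finite_E: "finite E" and bases_sub: "T \<in> B \<Longrightarrow> T \<subseteq> E" and bases_ne: "B \<noteq> {}"
    and exchange: "S \<in> B \<Longrightarrow> T \<in> B \<Longrightarrow> e \<in> S - T \<Longrightarrow>
      \<exists>g \<in> T - S. insert g (S - {e}) \<in> B \<and> insert e (T - {g}) \<in> B"
begin

section \<open>Optimal bases and single exchanges\<close>

definition opt :: "('e \<Rightarrow> real) \<Rightarrow> 'e set \<Rightarrow> bool" where
  "opt w T \<longleftrightarrow> T \<in> B \<and> (\<forall>T' \<in> B. sum w T \<le> sum w T')"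

lemma finite_bases: "finite B"
  using finite_E bases_sub by (meson PowI finite_Pow_iff finite_subset subsetI)

lemma finite_base: "T \<in> B \<Longrightarrow> finite T"
  using bases_sub finite_E finite_subset by blast

lemma ex_opt: "\<exists>T. opt w T"
proof -
  obtain T where "T \<in> B" "\<And>T'. T' \<in> B \<Longrightarrow> sum w T \<le> sum w T'"
    using ex_min_if_finite[of "sum w ` B"] finite_bases bases_ne
    by (metis (mono_tags, lifting) arg_min_if_finite(1) arg_min_least)
  then show ?thesis by (auto simp: opt_def)
qed

lemma sum_swap:
  assumes "finite T" "e \<in> T" "f \<notin> T"
  shows "sum w (insert f (T - {e})) = sum w T - w e + (w f :: real)"
  using assms by (simp add: sum_diff1)

lemma opt_swap_le:
  assumes "opt w T" "e \<in> T" "f \<notin> T" "insert f (T - {e}) \<in> B"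
  shows "w e \<le> w f"
  using assms sum_swap[of T e f w] finite_base[of T] by (force simp: opt_def)

text \<open>Any base \<open>T'\<close> is moved towards \<open>T\<close> by symmetric exchanges.
  Each one puts \<open>x\<close> in place of \<open>y\<close> in \<open>T'\<close>; local optimality
  applied to the opposite exchange in \<open>T\<close> shows that the weight does not grow.\<close>

lemma opt_if_locally_opt:
  assumes T: "T \<in> B" and loc: "\<And>e f. e \<in> T \<Longrightarrow> f \<in> E - T \<Longrightarrow> insert f (T - {e}) \<in> B \<Longrightarrow> w e \<le> w f"
  shows "opt w T"
proof -
  have "sum w T \<le> sum w T'" if "T' \<in> B" for T'
    using that
  proof (induction "card (T - T')" arbitrary: T' rule: less_induct)
    case less
    show ?case
    proof (cases "T \<subseteq> T'")
      case True
      have "T = T'"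
      proof (rule ccontr)
        assume "T \<noteq> T'"
        then obtain e where "e \<in> T' - T" using True by blast
        then show False using exchange[OF less.prems T] True by blast
      qed
      then show ?thesis by simp
    next
      case False
      then obtain x where x: "x \<in> T - T'" by blast
      then obtain y where y: "y \<in> T' - T" "insert y (T - {x}) \<in> B" "insert x (T' - {y}) \<in> B"
        using exchange[OF T less.prems x] by blast
      have "w x \<le> w y" using loc x y bases_sub[OF less.prems] by blast
      moreover have "sum w T \<le> sum w (insert x (T' - {y}))"
      proof (rule less.hyps)
        have "T - insert x (T' - {y}) = (T - T') - {x}" using y by blast
        then show "card (T - insert x (T' - {y})) < card (T - T')"
          using x finite_base[OF T] card_Diff1_less[of "T - T'" x] by simp
      qed (use y in auto)
      ultimately show ?thesis using sum_swap[of T' y x w] finite_base[OF less.prems] x y by auto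
    qed
  qed
  then show ?thesis using T by (simp add: opt_def)
qed

text \<open>The condition makes \<open>e\<close> the strict maximum of its fundamental cycle with
  respect to \<open>T\<close>. If \<open>e\<close> were in \<open>S\<close>, symmetric exchange
  would offer a strictly cheaper replacement.\<close>

lemma not_in_opt_if_cycle_max:
  assumes "opt w S" "T \<in> B" "e \<notin> T" "\<And>g. g \<in> T \<Longrightarrow> insert e (T - {g}) \<in> B \<Longrightarrow> w g < w e"
  shows "e \<notin> S"
proof
  assume "e \<in> S"
  then obtain g where g: "g \<in> T - S" "insert g (S - {e}) \<in> B" "insert e (T - {g}) \<in> B"
    using exchange[of S T e] assms by (auto simp: opt_def)
  then show False using opt_swap_le[OF assms(1) \<open>e \<in> S\<close> _ g(2)] assms(4)[of g] by force
qed

lemma in_opt_if_cut_min: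
  assumes "opt w S" "T \<in> B" "e \<in> T" "\<And>g. g \<in> E - T \<Longrightarrow> insert g (T - {e}) \<in> B \<Longrightarrow> w e < w g"
  shows "e \<in> S"
proof (rule ccontr)
  assume "e \<notin> S"
  then obtain g where g: "g \<in> S - T" "insert g (T - {e}) \<in> B" "insert e (S - {g}) \<in> B"
    using exchange[of T S e] assms by (auto simp: opt_def)
  moreover have "g \<in> E - T" using g assms(1) bases_sub by (auto simp: opt_def)
  ultimately show False
    using opt_swap_le[OF assms(1) _ _ g(3)] assms(4)[of g] \<open>e \<notin> S\<close> by force
qed

section \<open>Feasible query sets and mandatory elements\<close>

definition feas :: "('e \<Rightarrow> real) \<Rightarrow> ('e \<Rightarrow> real) \<Rightarrow> ('e \<Rightarrow> real) \<Rightarrow> 'e set \<Rightarrow> bool" where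
  "feas l u w Q \<longleftrightarrow> Q \<subseteq> E \<and> (\<exists>T \<in> B. \<forall>w'. (\<forall>e \<in> Q. w' e = w e) \<and>
     (\<forall>e \<in> E - Q. in_range (l e) (u e) (w' e)) \<longrightarrow> opt w' T)"

definition realization :: "('e \<Rightarrow> real) \<Rightarrow> ('e \<Rightarrow> real) \<Rightarrow> ('e \<Rightarrow> real) \<Rightarrow> bool" where
  "realization l u w \<longleftrightarrow> (\<forall>e \<in> E. in_range (l e) (u e) (w e))"

lemma feas_sub: "feas l u w Q \<Longrightarrow> Q \<subseteq> E"
  by (simp add: feas_def)

lemma feas_cong: "(\<And>e. e \<in> Q \<Longrightarrow> w e = v e) \<Longrightarrow> feas l u w Q \<longleftrightarrow> feas l u v Q"
  by (simp add: feas_def)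

lemma feas_mono:
  assumes "feas l u w Q" "Q \<subseteq> Q'" "Q' \<subseteq> E" "realization l u w"
  shows "feas l u w Q'"
proof -
  obtain T where T: "T \<in> B" "\<And>w'. (\<forall>e \<in> Q. w' e = w e) \<Longrightarrow>
     (\<forall>e \<in> E - Q. in_range (l e) (u e) (w' e)) \<Longrightarrow> opt w' T"
    using assms(1) by (auto simp: feas_def)
  show ?thesis unfolding feas_def
  proof (intro conjI bexI[OF _ T(1)] allI impI)
    fix w' assume w': "(\<forall>e \<in> Q'. w' e = w e) \<and> (\<forall>e \<in> E - Q'. in_range (l e) (u e) (w' e))"
    show "opt w' T"
    proof (rule T(2))
      show "\<forall>e \<in> Q. w' e = w e" using w' assms(2) by blast
      show "\<forall>e \<in> E - Q. in_range (l e) (u e) (w' e)"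
      proof
        fix e assume e: "e \<in> E - Q"
        show "in_range (l e) (u e) (w' e)"
          using w' assms(4) e by (cases "e \<in> Q'") (auto simp: realization_def)
      qed
    qed
  qed (use assms in auto)
qed

text \<open>Supplies a value so close to the end of an open interval that it exceeds finitely many
  fixed weights; this is how an unqueried element is made extremal.\<close>

lemma finite_dense:
  fixes a b :: real
  assumes "finite A" "a < b" "\<And>x. x \<in> A \<Longrightarrow> x < b"
  shows "\<exists>c. a < c \<and> c < b \<and> (\<forall>x \<in> A. x < c)"
proof -
  have "Max (insert a A) < b" using assms by simp
  then obtain c where "Max (insert a A) < c" "c < b" using dense by blast
  then show ?thesis using assms(1) by (auto simp: Max_less_iff)
qed

lemma finite_dense':
  fixes a b :: real
  assumes "finite A" "a < b" "\<And>x. x \<in> A \<Longrightarrow> a < x"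
  shows "\<exists>c. a < c \<and> c < b \<and> (\<forall>x \<in> A. c < x)"
  using finite_dense[of "uminus ` A" "- b" "- a"] assms
  by (metis (no_types, lifting) finite_imageI imageE image_eqI minus_less_iff neg_less_iff_less)

text \<open>If \<open>e\<close> stayed unqueried, one base would have to be optimal for every value
  of \<open>e\<close>. A value near the lower limit makes \<open>e\<close> the cheapest in its cut
  with respect to \<open>S\<close> and forces it in; a value near the upper limit makes it the most
  expensive on its cycle with respect to \<open>T\<close> and forces it out.\<close>

lemma mandatory:
  assumes "l e < u e" "realization l u w" "feas l u w Q" "S \<in> B" "T \<in> B" "e \<in> S" "e \<notin> T"
    and low: "\<And>g. g \<in> E - S \<Longrightarrow> insert g (S - {e}) \<in> B \<Longrightarrow> l e < w g"
    and high: "\<And>g. g \<in> T \<Longrightarrow> insert e (T - {g}) \<in> B \<Longrightarrow> w g < u e"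
  shows "e \<in> Q"
proof (rule ccontr)
  assume e: "e \<notin> Q"
  obtain R where R: "R \<in> B" "\<And>w'. (\<forall>e \<in> Q. w' e = w e) \<Longrightarrow>
     (\<forall>e \<in> E - Q. in_range (l e) (u e) (w' e)) \<Longrightarrow> opt w' R"
    using assms(3) by (auto simp: feas_def)
  have optR: "opt (w(e := c)) R" if "l e < c" "c < u e" for c
    by (rule R(2)) (use e that assms(2) in \<open>auto simp: in_range_def realization_def\<close>)
  have "\<exists>c. l e < c \<and> c < u e \<and> (\<forall>x \<in> w ` {g \<in> E - S. insert g (S - {e}) \<in> B}. c < x)"
    by (rule finite_dense') (use finite_E assms(1) low in auto)
  then obtain c where c: "l e < c" "c < u e" "\<And>g. g \<in> E - S \<Longrightarrow> insert g (S - {e}) \<in> B \<Longrightarrow> c < w g"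
    by auto
  have "e \<in> R"
    by (rule in_opt_if_cut_min[OF optR[OF c(1,2)] assms(4,6)]) (use c assms in auto)
  have "\<exists>c. l e < c \<and> c < u e \<and> (\<forall>x \<in> w ` {g \<in> T. insert e (T - {g}) \<in> B}. x < c)"
    by (rule finite_dense) (use finite_base[OF assms(5)] assms(1) high in auto)
  then obtain d where d: "l e < d" "d < u e" "\<And>g. g \<in> T \<Longrightarrow> insert e (T - {g}) \<in> B \<Longrightarrow> w g < d"
    by auto
  have "e \<notin> R"
    by (rule not_in_opt_if_cycle_max[OF optR[OF d(1,2)] assms(5,7)]) (use d assms in auto)
  with \<open>e \<in> R\<close> show False by simp
qed

text \<open>By \<open>opt_if_locally_opt\<close>, such a \<open>T\<close> is minimum for the lower
  and for the upper limits at once; later arguments compare single exchange pairs.\<close>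

definition dominating :: "('e \<Rightarrow> real) \<Rightarrow> ('e \<Rightarrow> real) \<Rightarrow> 'e set \<Rightarrow> bool" where
  "dominating l u T \<longleftrightarrow> T \<in> B \<and> (\<forall>e \<in> T. \<forall>f \<in> E - T. insert f (T - {e}) \<in> B \<longrightarrow>
     l e \<le> l f \<and> u e \<le> u f)"

text \<open>Maximising the common part makes exchanges between \<open>S\<close> and \<open>T\<close>
  strict, because an exchange of equal weight would enlarge it.\<close>

lemma ex_opt_max_inter:
  "\<exists>S T. opt a S \<and> opt b T \<and> (\<forall>S' T'. opt a S' \<longrightarrow> opt b T' \<longrightarrow> card (S' \<inter> T') \<le> card (S \<inter> T))"
proof -
  obtain S T where "opt a S" "opt b T" using ex_opt by blast
  moreover have "card (S' \<inter> T') \<le> card E" if "opt a S'" for S' T'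
    using that bases_sub finite_E by (intro card_mono) (auto simp: opt_def)
  ultimately obtain p where "opt a (fst p) \<and> opt b (snd p)"
    "\<forall>q. opt a (fst q) \<and> opt b (snd q) \<longrightarrow> card (fst q \<inter> snd q) \<le> card (fst p \<inter> snd p)"
    using ex_has_greatest_nat[of "\<lambda>p. opt a (fst p) \<and> opt b (snd p)" "(S, T)"
        "\<lambda>p. card (fst p \<inter> snd p)" "Suc (card E)"] by (auto simp: less_Suc_eq_le)
  then show ?thesis by (intro exI[of _ "fst p"] exI[of _ "snd p"]) auto
qed

text \<open>
  The ranks break ties as if the limits of an open interval were attained slightly inside it.
\<close>

lemma dominating_or_mandatory:
  assumes lu: "\<And>e. e \<in> E \<Longrightarrow> l e \<le> u e"
  shows "(\<exists>T. dominating l u T) \<or>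
    (\<exists>v \<in> E. l v < u v \<and> (\<forall>w Q. realization l u w \<longrightarrow> feas l u w Q \<longrightarrow> v \<in> Q))"
proof -
  define lows where "lows e = {g \<in> E. l g < l e \<or> (l g = l e \<and> l g = u g \<and> l e < u e)}" for e
  define upps where "upps e = {g \<in> E. u g < u e \<or> (u g = u e \<and> l g < u g \<and> l e = u e)}" for e
  define a where "a e = real (card (lows e))" for e
  define b where "b e = real (card (upps e))" for e
  have fin: "finite (lows e)" "finite (upps e)" for e using finite_E by (auto simp: lows_def upps_def)
  have a_less: "a e < a g" if "e \<in> E" "g \<in> E" "l e < l g \<or> (l e = l g \<and> l e = u e \<and> l g < u g)" for e g
  proof -
    have "lows e \<subseteq> lows g" "e \<in> lows g" "e \<notin> lows e" using that
      by (auto simp: lows_def)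
    then show ?thesis unfolding a_def of_nat_less_iff by (intro psubset_card_mono[OF fin(1)]) blast
  qed
  have b_less: "b e < b g" if "e \<in> E" "g \<in> E" "u e < u g \<or> (u e = u g \<and> l e < u e \<and> l g = u g)" for e g
  proof -
    have "upps e \<subseteq> upps g" "e \<in> upps g" "e \<notin> upps e" using that
      by (auto simp: upps_def)
    then show ?thesis unfolding b_def of_nat_less_iff by (intro psubset_card_mono[OF fin(2)]) blast
  qed
  obtain S T where ST: "opt a S" "opt b T"
    "\<And>S' T'. opt a S' \<Longrightarrow> opt b T' \<Longrightarrow> card (S' \<inter> T') \<le> card (S \<inter> T)"
    using ex_opt_max_inter[of a b] by blast
  have B: "S \<in> B" "T \<in> B" "S \<subseteq> E" "T \<subseteq> E" using ST bases_sub
    by (auto simp: opt_def)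
  have lowS: "l e \<le> l g \<and> (l e = l g \<longrightarrow> l e < u e \<longrightarrow> l g < u g)"
    if "e \<in> S" "g \<in> E - S" "insert g (S - {e}) \<in> B" for e g
    using opt_swap_le[OF ST(1) that(1) _ that(3)] a_less[of g e] lu[of g] that B by force
  have uppT: "u e \<le> u g \<and> (u e = u g \<longrightarrow> l g < u g \<longrightarrow> l e < u e)"
    if "e \<in> T" "g \<in> E - T" "insert g (T - {e}) \<in> B" for e g
    using opt_swap_le[OF ST(2) that(1) _ that(3)] b_less[of g e] lu[of e] that B by force
  show ?thesis
  \<comment> \<open>If the two bases differ, an exchange between them yields \<open>e\<close> and
    \<open>g\<close> such that \<open>e\<close> ranks strictly below \<open>g\<close> by lower
    limits and strictly above it by upper limits. Whether \<open>e\<close> belongs to a minimum base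
    then depends on its own value.\<close>
  proof (cases "S = T")
    case True
    then have "dominating l u T" using B lowS uppT by (auto simp: dominating_def)
    then show ?thesis by blast
  next
    case False
    have "\<exists>e. e \<in> S - T"
    proof (rule ccontr)
      assume "\<nexists>e. e \<in> S - T"
      then obtain e where "e \<in> T - S" using False by blast
      then show False using exchange[of T S e] B \<open>\<nexists>e. e \<in> S - T\<close> by blast
    qed
    then obtain e where e: "e \<in> S - T" by blast
    obtain g where g: "g \<in> T - S" "insert g (S - {e}) \<in> B" "insert e (T - {g}) \<in> B"
      using exchange[OF B(1,2) e] by blast
    have fin2: "finite (S \<inter> T)" using finite_base B by blast
    have "a e \<le> a g" by (rule opt_swap_le[OF ST(1)]) (use e g in auto)
    moreover have "a e \<noteq> a g"
    proof
      assume "a e = a g"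
      then have "opt a (insert g (S - {e}))"
        using ST(1) g e sum_swap[of S e g a] finite_base[OF B(1)] by (auto simp: opt_def)
      then have "card (insert g (S - {e}) \<inter> T) \<le> card (S \<inter> T)" using ST by blast
      moreover have "insert g (S - {e}) \<inter> T = insert g (S \<inter> T)" using e g by blast
      ultimately show False using g fin2 by auto
    qed
    ultimately have age: "a e < a g" by simp
    have "b g \<le> b e" by (rule opt_swap_le[OF ST(2)]) (use e g in auto)
    moreover have "b e \<noteq> b g"
    proof
      assume "b e = b g"
      then have "opt b (insert e (T - {g}))"
        using ST(2) g e sum_swap[of T g e b] finite_base[OF B(2)] by (auto simp: opt_def)
      then have "card (S \<inter> insert e (T - {g})) \<le> card (S \<inter> T)" using ST by blast
      moreover have "S \<inter> insert e (T - {g}) = insert e (S \<inter> T)" using e g by blast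
      ultimately show False using e fin2 by auto
    qed
    ultimately have bge: "b g < b e" by simp
    have eg: "e \<in> E" "g \<in> E" using e g B by auto
    \<comment> \<open>A trivial \<open>e\<close> would be squeezed: the ranks give
      \<open>l e \<le> l g\<close> and \<open>u g \<le> u e\<close>, so \<open>g\<close> would have
      the same single value and hence the same rank.\<close>
    have "l e < u e"
    proof (rule ccontr)
      assume "\<not> l e < u e"
      then have triv: "l e = u e" using lu eg by force
      have "a e \<le> a g \<Longrightarrow> l e \<le> l g" using a_less[of g e] eg by force
      then have lg: "l e \<le> l g" using age by simp
      have "u g \<le> u e" using b_less[of e g] eg bge by force
      then have "l g = l e" "u g = u e" using lg triv lu[OF eg(2)] by auto
      then have "a e = a g" using triv by (simp add: a_def lows_def)
      then show False using age by simp
    qed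
    moreover have "e \<in> Q" if w: "realization l u w" "feas l u w Q" for w Q
    proof (rule mandatory[of l e u w Q S T])
      fix h assume h: "h \<in> E - S" "insert h (S - {e}) \<in> B"
      then show "l e < w h"
        using lowS[of e h] e \<open>l e < u e\<close> w(1) by (force simp: realization_def in_range_def)
    next
      fix h assume h: "h \<in> T" "insert e (T - {h}) \<in> B"
      then show "w h < u e"
        using uppT[of h e] e eg \<open>l e < u e\<close> w(1) B
          by (force simp: realization_def in_range_def)
    qed (use e B w \<open>l e < u e\<close> in auto)
    ultimately show ?thesis using eg by blast
  qed
qed

text \<open>Under \<open>dominating\<close> no limit of \<open>e\<close> exceeds the corresponding
  limit of \<open>f\<close>, so the single inequality \<open>l f < u e\<close> expresses that the
  intervals intersect.\<close>

definition overlap :: "('e \<Rightarrow> real) \<Rightarrow> ('e \<Rightarrow> real) \<Rightarrow> 'e set \<Rightarrow> 'e \<Rightarrow> 'e \<Rightarrow> bool" where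
  "overlap l u T e f \<longleftrightarrow> e \<in> T \<and> f \<in> E - T \<and> insert f (T - {e}) \<in> B \<and> l f < u e"

lemma overlap_nontrivial:
  assumes "dominating l u T" "\<And>e. e \<in> E \<Longrightarrow> l e \<le> u e" "overlap l u T e f"
  shows "l e < u e" "l f < u f"
proof -
  have "l e \<le> l f" "u e \<le> u f" "l f < u e" using assms by (auto simp: dominating_def overlap_def)
  then show "l e < u e" "l f < u f" by auto
qed

text \<open>Without overlaps the limits alone order every exchange pair, so one base is locally
  optimal for all weights.\<close>

lemma feas_empty_if_no_overlap:
  assumes "dominating l u T" "\<And>e f. \<not> overlap l u T e f"
  shows "feas l u w {}"
proof -
  have "opt w' T" if w': "\<forall>e \<in> E. in_range (l e) (u e) (w' e)" for w'
  proof (rule opt_if_locally_opt)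
    fix e f assume ef: "e \<in> T" "f \<in> E - T" "insert f (T - {e}) \<in> B"
    then have "u e \<le> l f" using assms(2)[of e f] by (auto simp: overlap_def)
    moreover have "w' e \<le> u e" "l f \<le> w' f"
      using w' ef assms(1) bases_sub[of T] in_range_bounds[of "l e" "u e" "w' e"]
        in_range_bounds[of "l f" "u f" "w' f"] by (auto simp: dominating_def)
    ultimately show "w' e \<le> w' f" by linarith
  qed (use assms in \<open>simp add: dominating_def\<close>)
  then show ?thesis using assms by (auto simp: feas_def dominating_def)
qed

text \<open>This is \<open>mandatory\<close> for the bases \<open>T\<close> and
  \<open>insert f (T - {e})\<close>. The cycle of \<open>e\<close> in the second base is the cycle
  of \<open>f\<close> in the first; its other elements have upper limit at most \<open>u e\<close>
  if they overlap \<open>f\<close>, and at most \<open>l f\<close> otherwise.\<close>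

lemma mandatory_max_upper:
  assumes dom: "dominating l u T" and ov: "overlap l u T e f"
    and maxu: "\<And>e'. overlap l u T e' f \<Longrightarrow> u e' \<le> u e"
    and w: "realization l u w" "feas l u w Q" and wf: "w f < u e"
  shows "e \<in> Q"
proof (rule mandatory[of l e u w Q T "insert f (T - {e})"])
  have T: "T \<in> B" "T \<subseteq> E" using dom bases_sub by (auto simp: dominating_def)
  have ef: "e \<in> T" "f \<in> E - T" "insert f (T - {e}) \<in> B" "l f < u e"
    using ov by (auto simp: overlap_def)
  show "T \<in> B" "e \<in> T" "e \<notin> insert f (T - {e})" "insert f (T - {e}) \<in> B"
    using T ef by auto
  have d: "l e' \<le> l g \<and> u e' \<le> u g" if "e' \<in> T" "g \<in> E - T" "insert g (T - {e'}) \<in> B" for e' g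
    using dom that by (auto simp: dominating_def)
  show leue: "l e < u e" using d[OF ef(1-3)] ef by linarith
  have wr: "in_range (l x) (u x) (w x)" if "x \<in> E" for x using w that by (simp add: realization_def)
  fix g
  show "l e < w g" if "g \<in> E - T" "insert g (T - {e}) \<in> B"
    using d[OF ef(1) that] wr[of g] that leue by (auto simp: in_range_def)
  assume g: "g \<in> insert f (T - {e})" "insert e (insert f (T - {e}) - {g}) \<in> B"
  show "w g < u e"
  proof (cases "g = f")
    case True then show ?thesis using wf by simp
  next
    case False
    then have gT: "g \<in> T" "g \<noteq> e" using g by auto
    then have "insert e (insert f (T - {e}) - {g}) = insert f (T - {g})" using ef False by auto
    then have gf: "insert f (T - {g}) \<in> B" using g by simp
    have rg: "in_range (l g) (u g) (w g)" using wr gT T by auto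
    show ?thesis
    proof (cases "l f < u g")
      case True
      then have "u g \<le> u e" using maxu[of g] gT gf ef by (auto simp: overlap_def)
      moreover have "w g < u g" using rg True d[OF gT(1) ef(2) gf] by (auto simp: in_range_def)
      ultimately show ?thesis by simp
    next
      case False
      then show ?thesis using in_range_bounds[OF rg] ef(4) by simp
    qed
  qed
qed (use w in auto)

text \<open>Dual of \<open>mandatory_max_upper\<close>: the cut of \<open>f\<close> in
  \<open>insert f (T - {e})\<close> is the cut of \<open>e\<close> in \<open>T\<close>.\<close>

lemma mandatory_min_lower:
  assumes dom: "dominating l u T" and ov: "overlap l u T e f"
    and minl: "\<And>f'. overlap l u T e f' \<Longrightarrow> l f \<le> l f'"
    and w: "realization l u w" "feas l u w Q" and we: "l f < w e"
  shows "f \<in> Q"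
proof (rule mandatory[of l f u w Q "insert f (T - {e})" T])
  have T: "T \<in> B" "T \<subseteq> E" using dom bases_sub by (auto simp: dominating_def)
  have ef: "e \<in> T" "f \<in> E - T" "insert f (T - {e}) \<in> B" "l f < u e"
    using ov by (auto simp: overlap_def)
  show "T \<in> B" "f \<notin> T" "f \<in> insert f (T - {e})" "insert f (T - {e}) \<in> B"
    using T ef by auto
  have d: "l e' \<le> l g \<and> u e' \<le> u g" if "e' \<in> T" "g \<in> E - T" "insert g (T - {e'}) \<in> B" for e' g
    using dom that by (auto simp: dominating_def)
  show lfuf: "l f < u f" using d[OF ef(1-3)] ef by linarith
  have wr: "in_range (l x) (u x) (w x)" if "x \<in> E" for x using w that by (simp add: realization_def)
  fix g
  show "w g < u f" if "g \<in> T" "insert f (T - {g}) \<in> B"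
    using d[OF that(1) ef(2) that(2)] wr[of g] that lfuf T by (force simp: in_range_def)
  assume g: "g \<in> E - insert f (T - {e})" "insert g (insert f (T - {e}) - {f}) \<in> B"
  show "l f < w g"
  proof (cases "g = e")
    case True then show ?thesis using we by simp
  next
    case False
    then have gT: "g \<in> E - T" using g by auto
    have "insert f (T - {e}) - {f} = T - {e}" using ef by auto
    then have gf: "insert g (T - {e}) \<in> B" using g by simp
    have rg: "in_range (l g) (u g) (w g)" using wr gT by auto
    show ?thesis
    proof (cases "l g < u e")
      case True
      then have "l f \<le> l g" using minl[of g] gT gf ef by (auto simp: overlap_def)
      moreover have "l g < w g" using rg True d[OF ef(1) gT gf] by (auto simp: in_range_def)
      ultimately show ?thesis by simp
    next
      case False
      then show ?thesis using in_range_bounds[OF rg] ef(4) by simp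
    qed
  qed
qed (use w in auto)

lemma realization_upd: "realization l u w \<Longrightarrow> l x < c \<Longrightarrow> c < u x \<Longrightarrow> realization l u (w(x := c))"
  by (auto simp: realization_def in_range_def)

text \<open>
  If neither endpoint were queried, the other one could be moved to a value that makes this one
  mandatory.
\<close>

lemma witness_max_upper:
  assumes "dominating l u T" "overlap l u T e f" "\<And>e'. overlap l u T e' f \<Longrightarrow> u e' \<le> u e"
    and "realization l u w" "feas l u w Q"
  shows "e \<in> Q \<or> f \<in> Q"
proof (rule ccontr)
  assume n: "\<not> (e \<in> Q \<or> f \<in> Q)"
  have lf: "l f < u e" "u e \<le> u f" using assms by (auto simp: overlap_def dominating_def)
  obtain c where c: "l f < c" "c < u e" using dense[OF lf(1)] by blast
  then have c': "c < u f" using lf by simp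
  have "feas l u (w(f := c)) Q \<longleftrightarrow> feas l u w Q" by (rule feas_cong) (use n in auto)
  then have "feas l u (w(f := c)) Q" using assms(5) by simp
  then show False
    using mandatory_max_upper[OF assms(1-3) realization_upd[OF assms(4) c(1) c']] c n by simp
qed

lemma witness_min_lower:
  assumes "dominating l u T" "overlap l u T e f" "\<And>f'. overlap l u T e f' \<Longrightarrow> l f \<le> l f'"
    and "realization l u w" "feas l u w Q"
  shows "e \<in> Q \<or> f \<in> Q"
proof (rule ccontr)
  assume n: "\<not> (e \<in> Q \<or> f \<in> Q)"
  have lf: "l f < u e" "l e \<le> l f" using assms by (auto simp: overlap_def dominating_def)
  obtain c where c: "l f < c" "c < u e" using dense[OF lf(1)] by blast
  then have c': "l e < c" using lf by simp
  have "feas l u (w(e := c)) Q \<longleftrightarrow> feas l u w Q" by (rule feas_cong) (use n in auto)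
  then have "feas l u (w(e := c)) Q" using assms(5) by simp
  then show False
    using mandatory_min_lower[OF assms(1-3) realization_upd[OF assms(4) c' c(2)]] c n by simp
qed

end

subsection \<open>Minimum vertex covers of bipartite graphs\<close>

lemma ex_max_on:
  fixes f :: "'a \<Rightarrow> real"
  assumes "finite A" "A \<noteq> {}"
  shows "\<exists>x \<in> A. \<forall>y \<in> A. f y \<le> f x"
proof -
  have "Max (f ` A) \<in> f ` A" using assms by (intro Max_in) auto
  then obtain x where x: "x \<in> A" "Max (f ` A) = f x" by auto
  have "f y \<le> f x" if "y \<in> A" for y
    unfolding x(2)[symmetric] using assms(1) that by (intro Max_ge) auto
  then show ?thesis using x(1) by blast
qed

lemma ex_min_on:
  fixes f :: "'a \<Rightarrow> real"
  assumes "finite A" "A \<noteq> {}"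
  shows "\<exists>x \<in> A. \<forall>y \<in> A. f x \<le> f y"
  using ex_max_on[OF assms, of "\<lambda>x. - f x"] by simp

text \<open>Hall's marriage theorem by induction. If a nonempty proper subset \<open>J\<close> has
  no more candidates than members, \<open>J\<close> is matched first and the rest avoids its
  candidates \<open>U\<close>; otherwise every such subset has a spare candidate, and one pair can
  be fixed arbitrarily.\<close>

lemma hall:
  assumes "finite I" "\<And>i. i \<in> I \<Longrightarrow> finite (F i)"
    and "\<And>J. J \<subseteq> I \<Longrightarrow> card J \<le> card (\<Union>i\<in>J. F i)"
  shows "\<exists>h. inj_on h I \<and> (\<forall>i \<in> I. h i \<in> F i)"
  using assms
proof (induction "card I" arbitrary: I F rule: less_induct)
  case less
  note finI = less.prems(1) and finF = less.prems(2) and hall = less.prems(3)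
  show ?case
  proof (cases "\<exists>J. J \<noteq> {} \<and> J \<subset> I \<and> card (\<Union>i\<in>J. F i) \<le> card J")
    case True
    then obtain J where J: "J \<noteq> {}" "J \<subset> I" "card (\<Union>i\<in>J. F i) \<le> card J" by blast
    define U where "U = (\<Union>i\<in>J. F i)"
    have finJ: "finite J" using J finI finite_subset by blast
    have finU: "finite U" using finJ finF J by (auto simp: U_def)
    have "\<exists>h. inj_on h J \<and> (\<forall>i \<in> J. h i \<in> F i)"
    proof (rule less.hyps)
      show "card J < card I" using J finI by (simp add: psubset_card_mono)
      show "finite J" by (rule finJ)
      show "finite (F i)" if "i \<in> J" for i using that J finF by blast
      show "card K \<le> card (\<Union>i\<in>K. F i)" if "K \<subseteq> J" for K
        using that J hall by blast
    qed
    then obtain h1 where h1: "inj_on h1 J" "\<And>i. i \<in> J \<Longrightarrow> h1 i \<in> F i" by blast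
    have "\<exists>h. inj_on h (I - J) \<and> (\<forall>i \<in> I - J. h i \<in> F i - U)"
    proof (rule less.hyps)
      have "I - J \<subset> I" using J by blast
      then show "card (I - J) < card I" using finI by (simp add: psubset_card_mono)
      show "finite (I - J)" using finI by simp
      show "finite (F i - U)" if "i \<in> I - J" for i using that finF by simp
      fix K assume K: "K \<subseteq> I - J"
      then have finK: "finite K" using finI by (meson finite_Diff finite_subset)
      have "card K + card J = card (K \<union> J)" using K finK finJ by (subst card_Un_disjoint) auto
      also have "\<dots> \<le> card (\<Union>i\<in>K \<union> J. F i)" using K J by (intro hall) auto
      also have "(\<Union>i\<in>K \<union> J. F i) = (\<Union>i\<in>K. F i - U) \<union> U"
        by (auto simp: U_def)
      also have "card \<dots> = card (\<Union>i\<in>K. F i - U) + card U"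
        using finK finU finF K by (intro card_Un_disjoint) auto
      finally show "card K \<le> card (\<Union>i\<in>K. F i - U)" using J(3) by (simp add: U_def)
    qed
    then obtain h2 where h2: "inj_on h2 (I - J)" "\<And>i. i \<in> I - J \<Longrightarrow> h2 i \<in> F i - U" by blast
    define h where "h i = (if i \<in> J then h1 i else h2 i)" for i
    have "h1 i \<in> U" if "i \<in> J" for i using h1 that by (auto simp: U_def)
    then have "inj_on h I" using h1(1) h2 unfolding inj_on_def h_def by (metis DiffD2 DiffI)
    moreover have "\<forall>i \<in> I. h i \<in> F i" using h1 h2 by (auto simp: h_def)
    ultimately show ?thesis by blast
  next
    case False
    show ?thesis
    proof (cases "I = {}")
      case False
      then obtain i where i: "i \<in> I" by blast
      have "card {i} \<le> card (\<Union>j\<in>{i}. F j)" using i by (intro hall) auto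
      then obtain x where x: "x \<in> F i" by fastforce
      have "\<exists>h. inj_on h (I - {i}) \<and> (\<forall>j \<in> I - {i}. h j \<in> F j - {x})"
      proof (rule less.hyps)
        show "card (I - {i}) < card I" using i finI by (meson card_Diff1_less)
        show "finite (I - {i})" using finI by simp
        show "finite (F j - {x})" if "j \<in> I - {i}" for j using that finF by simp
        fix K assume K: "K \<subseteq> I - {i}"
        show "card K \<le> card (\<Union>j\<in>K. F j - {x})"
        proof (cases "K = {}")
          case False
          have "K \<subset> I" using K i by blast
          then have "card K < card (\<Union>j\<in>K. F j)"
            using \<open>\<nexists>J. J \<noteq> {} \<and> J \<subset> I \<and> card (\<Union>i\<in>J. F i) \<le> card J\<close> False
              by (meson not_le)
          moreover have "card (\<Union>j\<in>K. F j) - 1 \<le> card ((\<Union>j\<in>K. F j) - {x})"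
            by (metis One_nat_def card_Diff_singleton_if diff_le_self le_refl)
          moreover have "(\<Union>j\<in>K. F j - {x}) = (\<Union>j\<in>K. F j) - {x}" by blast
          then have "card (\<Union>j\<in>K. F j - {x}) = card ((\<Union>j\<in>K. F j) - {x})"
            by (rule arg_cong)
          ultimately show ?thesis by linarith
        qed simp
      qed
      then obtain h where h: "inj_on h (I - {i})" "\<And>j. j \<in> I - {i} \<Longrightarrow> h j \<in> F j - {x}" by blast
      have "inj_on (h(i := x)) I" using h by (auto simp: inj_on_def)
      moreover have "\<forall>j \<in> I. (h(i := x)) j \<in> F j" using h x by auto
      ultimately show ?thesis by blast
    qed simp
  qed
qed

text \<open>A minimum cover \<open>C\<close> is matched into its complement. Hall's condition holds
  because replacing a part \<open>J\<close> of the cover on one side by its neighbours outside the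
  cover gives another cover. The partners of the two halves lie on opposite sides, so the matchings
  combine injectively.\<close>

lemma koenig:
  assumes fin: "finite N" and bip: "fst ` N \<inter> snd ` N = {}"
  shows "\<exists>C h. finite C \<and> (\<forall>a b. (a, b) \<in> N \<longrightarrow> a \<in> C \<or> b \<in> C) \<and> inj_on h C \<and> h ` C \<inter> C = {} \<and>
    (\<forall>c \<in> C. (c, h c) \<in> N \<or> (h c, c) \<in> N)"
proof -
  define cover where "cover C \<longleftrightarrow> C \<subseteq> fst ` N \<union> snd ` N \<and> (\<forall>a b. (a, b) \<in> N \<longrightarrow> a \<in> C \<or> b \<in> C)" for C
  have "cover (fst ` N \<union> snd ` N)" by (force simp: cover_def)
  then obtain C where C: "cover C" "\<And>C'. cover C' \<Longrightarrow> card C \<le> card C'"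
    using ex_has_least_nat[of cover _ card] by blast
  have finC: "finite C" using C(1) fin by (auto simp: cover_def intro: finite_subset)
  \<comment> \<open>\<open>M\<close> is \<open>N\<close> or its converse, so one argument serves
    both sides.\<close>
  have half: "\<exists>h. inj_on h (C \<inter> X) \<and> (\<forall>c \<in> C \<inter> X. h c \<in> {b. (c, b) \<in> M} - C)"
    if M: "(M, X) = (N, fst ` N) \<or> (M, X) = (N\<inverse>, snd ` N)" for M X
  proof (rule hall)
    have "snd ` (N\<inverse>) = fst ` N" by (force simp: image_iff)
    then have XM: "X \<inter> snd ` M = {}" "snd ` M \<subseteq> fst ` N \<union> snd ` N"
      using M bip by auto
    show "finite (C \<inter> X)" using finC by simp
    have finM: "finite M" using M fin by auto
    have "{b. (c, b) \<in> M} \<subseteq> snd ` M" for c by force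
    then show "finite ({b. (c, b) \<in> M} - C)" for c
      using finM by (meson finite_Diff finite_imageI finite_subset)
    fix J assume J: "J \<subseteq> C \<inter> X"
    define U where "U = (\<Union>c\<in>J. {b. (c, b) \<in> M} - C)"
    have "U \<subseteq> snd ` M" by (force simp: U_def)
    then have finU: "finite U" using finM finite_subset by blast
    have cov: "cover (C - J \<union> U)"
    proof -
      have "a \<in> C - J \<union> U \<or> b \<in> C - J \<union> U" if "(a, b) \<in> M" for a b
      proof -
        have "b \<in> snd ` M" using that by force
        then have "b \<notin> J" using J XM(1) by blast
        moreover have "a \<in> C \<or> b \<in> C" using that M C(1) by (auto simp: cover_def)
        ultimately show ?thesis using that by (auto simp: U_def)
      qed
      moreover have "C - J \<union> U \<subseteq> fst ` N \<union> snd ` N"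
        using C(1) subset_trans[OF \<open>U \<subseteq> snd ` M\<close> XM(2)] unfolding cover_def by blast
      ultimately show ?thesis using M by (auto simp: cover_def)
    qed
    have finJ: "finite J" using J finC finite_subset by blast
    have "card C \<le> card (C - J) + card U"
      using C(2)[OF cov] card_Un_le[of "C - J" U] by linarith
    moreover have "card (C - J) = card C - card J" using J finJ by (intro card_Diff_subset) auto
    moreover have "card J \<le> card C" using J finC by (intro card_mono) auto
    ultimately show "card J \<le> card U" by linarith
  qed
  obtain h1 where h1: "inj_on h1 (C \<inter> fst ` N)" "\<And>c. c \<in> C \<inter> fst ` N \<Longrightarrow> (c, h1 c) \<in> N \<and> h1 c \<notin> C"
    using half[of N "fst ` N"] by auto
  obtain h2 where h2: "inj_on h2 (C \<inter> snd ` N)" "\<And>c. c \<in> C \<inter> snd ` N \<Longrightarrow> (h2 c, c) \<in> N \<and> h2 c \<notin> C"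
    using half[of "N\<inverse>" "snd ` N"] by auto
  define h where "h c = (if c \<in> fst ` N then h1 c else h2 c)" for c
  have CN: "c \<in> fst ` N \<or> c \<in> snd ` N" if "c \<in> C" for c using C(1) that
    by (auto simp: cover_def)
  have hA: "(c, h c) \<in> N \<and> h c \<notin> C" if "c \<in> C" "c \<in> fst ` N" for c using h1 that
    by (simp add: h_def)
  have hB: "(h c, c) \<in> N \<and> h c \<notin> C" if "c \<in> C" "c \<notin> fst ` N" for c
    using h2 that CN[OF that(1)] by (simp add: h_def)
  have "inj_on h C"
  proof (rule inj_onI)
    fix c d assume cd: "c \<in> C" "d \<in> C" "h c = h d"
    have "h b \<in> snd ` N" if "b \<in> C" "b \<in> fst ` N" for b using hA[OF that] by force
    moreover have "h b \<in> fst ` N" if "b \<in> C" "b \<notin> fst ` N" for b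
      using hB[OF that] by force
    ultimately have "c \<in> fst ` N \<longleftrightarrow> d \<in> fst ` N"
      using cd bip by (metis IntI empty_iff)
    then show "c = d"
      using cd CN[of c] CN[of d] inj_onD[OF h1(1), of c d] inj_onD[OF h2(1), of c d]
      by (cases "c \<in> fst ` N") (simp_all add: h_def)
  qed
  moreover have "h ` C \<inter> C = {}" "\<forall>c \<in> C. (c, h c) \<in> N \<or> (h c, c) \<in> N"
    using hA hB by blast+
  ultimately show ?thesis using C(1) finC unfolding cover_def by blast
qed

subsection \<open>Choosing the next query\<close>

locale uncertain_system = exchange_system E B for E :: "'e set" and B +
  fixes l u :: "'e \<Rightarrow> real"
  assumes lower_le_upper: "e \<in> E \<Longrightarrow> l e \<le> u e"
begin

text \<open>For a limit function \<open>b\<close>, these are the limits after the answers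
  \<open>p\<close> on \<open>Q\<close>: both limits of a queried element collapse to its
  weight.\<close>

definition reveal :: "('e \<Rightarrow> real) \<Rightarrow> 'e set \<Rightarrow> ('e \<Rightarrow> real) \<Rightarrow> 'e \<Rightarrow> real" where
  "reveal p Q b = (\<lambda>e. if e \<in> Q then p e else b e)"

definition compat :: "('e \<Rightarrow> real) \<Rightarrow> 'e set \<Rightarrow> ('e \<Rightarrow> real) \<Rightarrow> bool" where
  "compat p Q w \<longleftrightarrow> realization l u w \<and> (\<forall>e \<in> Q. w e = p e)"

abbreviation solves :: "('e \<Rightarrow> real) \<Rightarrow> 'e set \<Rightarrow> bool" where
  "solves w P \<equiv> feas l u w P"

lemma compat_mono: "compat p Q w \<Longrightarrow> R \<subseteq> Q \<Longrightarrow> compat p R w"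
  by (auto simp: compat_def)

lemma compat_self: "realization l u p \<Longrightarrow> compat p Q p"
  by (simp add: compat_def)

lemma realization_reveal:
  "compat p Q w \<Longrightarrow> realization (reveal p Q l) (reveal p Q u) w"
  by (auto simp: compat_def realization_def reveal_def in_range_def)

text \<open>Feasibility survives shrinking intervals, so lower bounds proved for the revealed limits
  hold for the original problem.\<close>

lemma solves_reveal:
  assumes p: "realization l u p" and w: "compat p Q w" and P: "solves w P"
  shows "feas (reveal p Q l) (reveal p Q u) w P"
proof -
  obtain T where T: "T \<in> B" "\<And>w'. (\<forall>e \<in> P. w' e = w e) \<Longrightarrow>
     (\<forall>e \<in> E - P. in_range (l e) (u e) (w' e)) \<Longrightarrow> opt w' T"
    using P by (auto simp: feas_def)
  show ?thesis unfolding feas_def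
  proof (intro conjI bexI[OF _ T(1)] allI impI)
    fix w' assume w': "(\<forall>e \<in> P. w' e = w e) \<and>
      (\<forall>e \<in> E - P. in_range (reveal p Q l e) (reveal p Q u e) (w' e))"
    show "opt w' T"
    proof (rule T(2))
      show "\<forall>e \<in> E - P. in_range (l e) (u e) (w' e)"
      proof
        fix e assume e: "e \<in> E - P"
        then have "in_range (reveal p Q l e) (reveal p Q u e) (w' e)" using w' by blast
        then show "in_range (l e) (u e) (w' e)"
          using p e by (cases "e \<in> Q") (auto simp: realization_def reveal_def in_range_def)
      qed
    qed (use w' in blast)
  qed (use P in \<open>simp add: feas_def\<close>)
qed

text \<open>In the converse direction the knowledge has to be paid for: \<open>Q\<close> becomes
  part of the query set.\<close>

lemma solves_if_feas_reveal:
  assumes Q: "Q \<subseteq> E" and w: "compat p Q w" and P: "feas (reveal p Q l) (reveal p Q u) w P"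
  shows "solves w (P \<union> Q)"
proof -
  obtain T where T: "T \<in> B" "\<And>w'. (\<forall>e \<in> P. w' e = w e) \<Longrightarrow>
     (\<forall>e \<in> E - P. in_range (reveal p Q l e) (reveal p Q u e) (w' e)) \<Longrightarrow> opt w' T"
    using P by (auto simp: feas_def)
  show ?thesis unfolding feas_def
  proof (intro conjI bexI[OF _ T(1)] allI impI)
    fix w' assume w': "(\<forall>e \<in> P \<union> Q. w' e = w e) \<and> (\<forall>e \<in> E - (P \<union> Q). in_range (l e) (u e) (w' e))"
    show "opt w' T"
    proof (rule T(2))
      show "\<forall>e \<in> E - P. in_range (reveal p Q l e) (reveal p Q u e) (w' e)"
        using w' w by (auto simp: reveal_def in_range_def compat_def)
    qed (use w' in blast)
  qed (use P Q in \<open>auto simp: feas_def\<close>)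
qed

definition witness :: "('e \<Rightarrow> real) \<Rightarrow> 'e set \<Rightarrow> 'e \<Rightarrow> 'e \<Rightarrow> bool" where
  "witness p Q v q \<longleftrightarrow> (\<forall>w P. compat p Q w \<longrightarrow> solves w P \<longrightarrow> v \<in> P \<or> q \<in> P)"

definition forced :: "('e \<Rightarrow> real) \<Rightarrow> 'e set \<Rightarrow> 'e \<Rightarrow> bool" where
  "forced p Q v \<longleftrightarrow> (\<forall>w P. compat p Q w \<longrightarrow> solves w P \<longrightarrow> v \<in> P)"

text \<open>Only the first components become known along the plan; the second ones are partners that
  certify the charge.\<close>

fun witness_plan :: "('e \<Rightarrow> real) \<Rightarrow> 'e set \<Rightarrow> ('e \<times> 'e) list \<Rightarrow> bool" where
  "witness_plan p Q [] \<longleftrightarrow> solves p Q"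
| "witness_plan p Q ((v, q) # ps) \<longleftrightarrow> witness p Q v q \<and> witness_plan p (insert v Q) ps"

lemma reveal_in_range:
  "realization l u p \<Longrightarrow> e \<in> E \<Longrightarrow> in_range (reveal p Q l e) (reveal p Q u e) (p e)"
  by (auto simp: realization_def reveal_def in_range_def)

lemma reveal_le: "e \<in> E \<Longrightarrow> reveal p Q l e \<le> reveal p Q u e"
  using lower_le_upper by (simp add: reveal_def)

text \<open>
  The cover elements outside the base come first, by increasing lower limit, then those in the
  base, by decreasing upper limit: the partner of the current element lies outside the cover, so
  everything else it overlaps is in the cover and not yet queried, which makes the current element
  extremal.
\<close>

lemma cover_witness_plan:
  fixes p :: "'e \<Rightarrow> real"
  assumes p: "realization l u p" and "Q \<subseteq> E" and "finite C"
    and "dominating (reveal p Q l) (reveal p Q u) T"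
    and "\<And>e f. overlap (reveal p Q l) (reveal p Q u) T e f \<Longrightarrow>
      reveal p Q u e \<le> p f \<and> p e \<le> reveal p Q l f"
    and "\<And>e f. overlap (reveal p Q l) (reveal p Q u) T e f \<Longrightarrow> e \<in> C \<or> f \<in> C"
    and "inj_on h C" and "h ` C \<inter> C = {}"
    and "\<And>c. c \<in> C \<Longrightarrow> overlap (reveal p Q l) (reveal p Q u) T c (h c) \<or>
      overlap (reveal p Q l) (reveal p Q u) T (h c) c"
  shows "\<exists>cs. distinct cs \<and> set cs = C \<and> witness_plan p Q (map (\<lambda>c. (c, h c)) cs)"
  using assms(2-)
proof (induction "card C" arbitrary: Q C)
  case 0
  let ?l = "reveal p Q l" and ?u = "reveal p Q u"
  have "C = {}" using 0 by simp
  then have "feas ?l ?u p {}" using 0 by (intro feas_empty_if_no_overlap) auto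
  then have "solves p ({} \<union> Q)"
    using 0 p by (intro solves_if_feas_reveal) (auto intro: compat_self)
  then show ?case using \<open>C = {}\<close> by (intro exI[of _ "[]"]) simp
next
  case (Suc n)
  let ?l = "reveal p Q l" and ?u = "reveal p Q u"
  note QE = Suc.prems(1) and finC = Suc.prems(2) and dom = Suc.prems(3) and good = Suc.prems(4)
    and cov = Suc.prems(5) and inj = Suc.prems(6) and hC = Suc.prems(7) and match = Suc.prems(8)
  have T: "T \<in> B" "T \<subseteq> E" using dom bases_sub by (auto simp: dominating_def)
  have Cne: "C \<noteq> {}" using Suc.hyps(2) by auto
  have "\<exists>v \<in> C. witness p Q v (h v)"
  proof (cases "C - T = {}")
    case False
    obtain v where v: "v \<in> C - T" "\<And>f. f \<in> C - T \<Longrightarrow> ?l v \<le> ?l f"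
      using ex_min_on[of "C - T" ?l] finC False by blast
    then have ov: "overlap ?l ?u T (h v) v" using match[of v] by (auto simp: overlap_def)
    have "?l v \<le> ?l f" if "overlap ?l ?u T (h v) f" for f
      using cov[OF that] hC v that by (auto simp: overlap_def)
    from witness_min_lower[OF dom ov this] have "witness p Q v (h v)"
      unfolding witness_def using realization_reveal solves_reveal[OF p] by blast
    then show ?thesis using v by blast
  next
    case True
    obtain v where v: "v \<in> C" "\<And>e. e \<in> C \<Longrightarrow> ?u e \<le> ?u v"
      using ex_max_on[OF finC Cne, of ?u] by blast
    then have ov: "overlap ?l ?u T v (h v)" using match[of v] True by (auto simp: overlap_def)
    have "?u e \<le> ?u v" if "overlap ?l ?u T e (h v)" for e
      using cov[OF that] hC v that by (auto simp: overlap_def)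
    from witness_max_upper[OF dom ov this] have "witness p Q v (h v)"
      unfolding witness_def using realization_reveal solves_reveal[OF p] by blast
    then show ?thesis using v by blast
  qed
  then obtain v where v: "v \<in> C" "witness p Q v (h v)" by blast
  let ?l' = "reveal p (insert v Q) l" and ?u' = "reveal p (insert v Q) u"
  have upd: "?l' = ?l(v := p v)" "?u' = ?u(v := p v)" by (auto simp: reveal_def)
  have vE: "v \<in> E" using match[OF v(1)] T by (auto simp: overlap_def)
  have rng: "?l e \<le> p e" "p e \<le> ?u e" if "e \<in> E" for e
    using in_range_bounds[OF reveal_in_range[OF p that]] by auto
  \<comment> \<open>The condition on the predictions extends from overlaps to all exchange pairs,
    since without overlap \<open>?u e \<le> ?l f\<close>.\<close>
  have good': "?u e \<le> p f \<and> p e \<le> ?l f" if "e \<in> T" "f \<in> E - T" "insert f (T - {e}) \<in> B" for e f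
    using good[of e f] that rng[of e] rng[of f] T by (force simp: overlap_def)
  have dom': "dominating ?l' ?u' T"
    unfolding dominating_def
  proof (intro conjI ballI impI T)
    fix e f assume ef: "e \<in> T" "f \<in> E - T" "insert f (T - {e}) \<in> B"
    have "?l e \<le> ?l f" "?u e \<le> ?u f" using dom ef by (auto simp: dominating_def)
    moreover have "e \<in> E" "f \<in> E" using ef T by auto
    ultimately show "?l' e \<le> ?l' f" "?u' e \<le> ?u' f"
      using good'[OF ef] rng[of e] rng[of f] reveal_le[of e p Q] reveal_le[of f p Q]
      unfolding upd by auto
  qed
  \<comment> \<open>Revealing \<open>v\<close> removes exactly its own overlaps: its predicted
    weight lies outside the intervals that \<open>v\<close> overlapped.\<close>
  have ov': "overlap ?l' ?u' T e f \<longleftrightarrow> overlap ?l ?u T e f \<and> e \<noteq> v \<and> f \<noteq> v" for e f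
  proof (cases "e \<in> T \<and> f \<in> E - T \<and> insert f (T - {e}) \<in> B")
    case True
    then show ?thesis using good'[of e f] unfolding upd overlap_def by auto
  qed (auto simp: overlap_def)
  have "\<exists>cs. distinct cs \<and> set cs = C - {v} \<and>
    witness_plan p (insert v Q) (map (\<lambda>c. (c, h c)) cs)"
  proof (rule Suc.hyps(1))
    show "n = card (C - {v})" using Suc.hyps(2) v by simp
    show "insert v Q \<subseteq> E" "finite (C - {v})" using QE vE finC by auto
    show "dominating ?l' ?u' T" by (rule dom')
    show "?u' e \<le> p f \<and> p e \<le> ?l' f" if "overlap ?l' ?u' T e f" for e f
      using that[unfolded ov'] good[of e f] unfolding upd by auto
    show "e \<in> C - {v} \<or> f \<in> C - {v}" if "overlap ?l' ?u' T e f" for e f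
      using that cov[of e f] unfolding ov' by auto
    show "inj_on h (C - {v})" "h ` (C - {v}) \<inter> (C - {v}) = {}"
      using inj hC by (auto simp: inj_on_def)
    show "overlap ?l' ?u' T c (h c) \<or> overlap ?l' ?u' T (h c) c" if c: "c \<in> C - {v}" for c
    proof -
      have "h c \<noteq> v" using hC c v(1) by auto
      then show ?thesis using match[of c] c unfolding ov' by auto
    qed
  qed
  then obtain cs where "distinct cs" "set cs = C - {v}"
    "witness_plan p (insert v Q) (map (\<lambda>c. (c, h c)) cs)" by blast
  then show ?case using v by (intro exI[of _ "v # cs"]) auto
qed

text \<open>Without a dominating base there is a mandatory element. With one, an overlap in which
  the prediction of one element falls inside the interval of the other yields a predicted mandatory
  element. If there is no such overlap, the overlap graph only loses the queried elements while
  predictions come true, and querying a minimum vertex cover solves the problem.\<close>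

lemma next_query:
  assumes p: "realization l u p" and Q: "Q \<subseteq> E"
  obtains (solved) "solves p Q"
  | (forced) v where "v \<in> E - Q" "forced p Q v"
  | (predicted) v q where "v \<in> E - Q" "q \<in> E - Q" "v \<noteq> q" "witness p Q v q" "forced p (insert q Q) v"
  | (cover) ps where "witness_plan p Q ps" "distinct (map fst ps @ map snd ps)"
      "set (map fst ps @ map snd ps) \<subseteq> E - Q"
proof -
  let ?l = "reveal p Q l" and ?u = "reveal p Q u"
  have le: "?l e \<le> ?u e" if "e \<in> E" for e using that by (rule reveal_le)
  note real = realization_reveal solves_reveal[OF p]
  consider (m) v where "v \<in> E" "?l v < ?u v" "\<And>w P. realization ?l ?u w \<Longrightarrow> feas ?l ?u w P \<Longrightarrow> v \<in> P"
    | (d) T where "dominating ?l ?u T"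
    using dominating_or_mandatory[of ?l ?u] le by blast
  then show thesis
  proof cases
    case m
    then have "v \<in> E - Q" by (auto simp: reveal_def)
    moreover have "forced p Q v" unfolding forced_def using m(3) real by blast
    ultimately show thesis by (rule that(2))
  next
    case d
    have T: "T \<subseteq> E" using d bases_sub by (auto simp: dominating_def)
    have ovE: "e \<in> E - Q" "f \<in> E - Q" "e \<noteq> f" if "overlap ?l ?u T e f" for e f
      using overlap_nontrivial[OF d le that] that T
        by (auto simp: overlap_def reveal_def split: if_splits)
    show thesis
    proof (cases "\<forall>e f. overlap ?l ?u T e f \<longrightarrow> ?u e \<le> p f \<and> p e \<le> ?l f")
      case False
      then obtain e0 f0 where ov0: "overlap ?l ?u T e0 f0" "p f0 < ?u e0 \<or> ?l f0 < p e0" by force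
      from ov0(2) show thesis
      proof
        assume lt: "p f0 < ?u e0"
        let ?M = "{e. overlap ?l ?u T e f0}"
        have "finite ?M" by (rule finite_subset[OF _ finite_E]) (use ovE in blast)
        \<comment> \<open>The element shown to be mandatory need not be \<open>e0\<close>: it is a
          neighbour of \<open>f0\<close> with the largest upper limit, which the predicted weight of
          \<open>f0\<close> undercuts as well.\<close>
        then obtain v where v: "overlap ?l ?u T v f0" "\<And>e. overlap ?l ?u T e f0 \<Longrightarrow> ?u e \<le> ?u v"
          using ex_max_on[of ?M ?u] ov0(1) by blast
        have "?u e0 \<le> ?u v" using v(2) ov0(1) by blast
        then have lt': "p f0 < ?u v" using lt by simp
        have "witness p Q v f0"
          unfolding witness_def using real witness_max_upper[OF d v] by blast
        moreover have "forced p (insert f0 Q) v"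
          unfolding forced_def
        proof (intro allI impI)
          fix w P assume w: "compat p (insert f0 Q) w" "solves w P"
          then have "compat p Q w" "w f0 < ?u v" using lt' by (auto simp: compat_def)
          then show "v \<in> P" using mandatory_max_upper[OF d v] real w(2) by blast
        qed
        ultimately show thesis using that(3)[of v f0] ovE[OF v(1)] by blast
      next
        assume lt: "?l f0 < p e0"
        let ?M = "{f. overlap ?l ?u T e0 f}"
        have "finite ?M" by (rule finite_subset[OF _ finite_E]) (use ovE in blast)
        then obtain v where v: "overlap ?l ?u T e0 v" "\<And>f. overlap ?l ?u T e0 f \<Longrightarrow> ?l v \<le> ?l f"
          using ex_min_on[of ?M ?l] ov0(1) by blast
        have "?l v \<le> ?l f0" using v(2) ov0(1) by blast
        then have lt': "?l v < p e0" using lt by simp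
        have "witness p Q v e0"
          unfolding witness_def using real witness_min_lower[OF d v] by blast
        moreover have "forced p (insert e0 Q) v"
          unfolding forced_def
        proof (intro allI impI)
          fix w P assume w: "compat p (insert e0 Q) w" "solves w P"
          then have "compat p Q w" "?l v < w e0" using lt' by (auto simp: compat_def)
          then show "v \<in> P" using mandatory_min_lower[OF d v] real w(2) by blast
        qed
        ultimately show thesis using that(3)[of v e0] ovE[OF v(1)] by blast
      qed
    next
      case True
      define N where "N = {(e, f). overlap ?l ?u T e f}"
      have "N \<subseteq> E \<times> E" using ovE by (auto simp: N_def)
      then have "finite N" using finite_E by (meson finite_SigmaI finite_subset)
      moreover have "fst ` N \<inter> snd ` N = {}" by (auto simp: N_def overlap_def)
      ultimately have "\<exists>C h. finite C \<and> (\<forall>a b. (a, b) \<in> N \<longrightarrow> a \<in> C \<or> b \<in> C) \<and> inj_on h C \<and>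
        h ` C \<inter> C = {} \<and> (\<forall>c \<in> C. (c, h c) \<in> N \<or> (h c, c) \<in> N)"
          by (rule koenig)
      then obtain C h where Ch: "finite C" "\<forall>a b. (a, b) \<in> N \<longrightarrow> a \<in> C \<or> b \<in> C" "inj_on h C"
        "h ` C \<inter> C = {}" "\<forall>c \<in> C. (c, h c) \<in> N \<or> (h c, c) \<in> N"
        by (elim exE conjE)
      obtain cs where cs: "distinct cs" "set cs = C" "witness_plan p Q (map (\<lambda>c. (c, h c)) cs)"
        using cover_witness_plan[OF p Q Ch(1) d _ _ Ch(3,4)] True Ch(2,5) by (auto simp: N_def)
      have "c \<in> E - Q" "h c \<in> E - Q" if "c \<in> C" for c
        using bspec[OF Ch(5) that] ovE by (auto simp: N_def)
      then show thesis
        using that(4)[OF cs(3)] cs Ch(3,4) by (auto simp: distinct_map comp_def)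
    qed
  qed
qed

end

subsection \<open>Decision trees\<close>

datatype 'e dtree = Stop | Query 'e "real \<Rightarrow> 'e dtree"

primrec run :: "'e dtree \<Rightarrow> ('e \<Rightarrow> real) \<Rightarrow> 'e list" where
  "run Stop w = []"
| "run (Query e k) w = e # run (k (w e)) w"

text \<open>Queries a whole list regardless of the answers, which overwrite the default
  \<open>v\<close>; the continuation may depend on all of them.\<close>

fun query_all :: "'e list \<Rightarrow> (('e \<Rightarrow> real) \<Rightarrow> 'e dtree) \<Rightarrow> ('e \<Rightarrow> real) \<Rightarrow> 'e dtree" where
  "query_all [] k v = k v"
| "query_all (x # xs) k v = Query x (\<lambda>r. query_all xs k (v(x := r)))"

lemma run_query_all:
  "run (query_all xs k v) w = xs @ run (k (\<lambda>e. if e \<in> set xs then w e else v e)) w"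
proof (induction xs arbitrary: v)
  case (Cons x xs)
  have "(\<lambda>e. if e \<in> set xs then w e else (v(x := w x)) e) =
    (\<lambda>e. if e \<in> set (x # xs) then w e else v e)" by auto
  then show ?case by (simp add: Cons)
qed simp

text \<open>Only the answers in the history are replayed; the tree determines which elements they
  belong to.\<close>

fun strategy_of :: "'e dtree \<Rightarrow> 'e strategy" where
  "strategy_of t [] = (case t of Stop \<Rightarrow> None | Query e k \<Rightarrow> Some e)"
| "strategy_of t (x # h) = (case t of Stop \<Rightarrow> None | Query e k \<Rightarrow> strategy_of (k (snd x)) h)"

lemma strategy_of_run:
  "k \<le> length (run t w) \<Longrightarrow> strategy_of t (map (\<lambda>e. (e, w e)) (take k (run t w))) =
    (if k < length (run t w) then Some (run t w ! k) else None)"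
  by (induction k arbitrary: t) (case_tac t; simp)+

text \<open>A run without repetitions has at most as many steps as there are edges, so the iteration
  in \<open>queries\<close> is long enough; after the end of the run the history stays
  constant.\<close>

lemma queries_strategy_of:
  assumes d: "distinct (run t w)" and sub: "set (run t w) \<subseteq> edges (graph X)"
    and fin: "finite (edges (graph X))"
  shows "queries X w (strategy_of t) = set (run t w)"
proof -
  let ?E = "edges (graph X)" and ?r = "run t w"
  have "(query_step ?E w (strategy_of t) ^^ k) [] = map (\<lambda>e. (e, w e)) (take k ?r)" for k
  proof (induction k)
    case (Suc k)
    show ?case
    proof (cases "k < length ?r")
      case True
      have "?r ! k \<notin> set (take k ?r)"
        using d True by (metis distinct_take not_distinct_conv_prefix take_Suc_conv_app_nth)
      moreover have "?r ! k \<in> ?E" using True sub nth_mem by blast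
      ultimately show ?thesis
        using Suc strategy_of_run[of k t w] True
        by (simp add: query_step_def take_Suc_conv_app_nth image_image)
    next
      case False
      then show ?thesis using Suc strategy_of_run[of "length ?r" t w] by (simp add: query_step_def)
    qed
  qed simp
  moreover have "length ?r \<le> card ?E" using d sub fin by (metis card_mono distinct_card)
  ultimately show ?thesis by (simp add: queries_def image_image)
qed

subsection \<open>Following the predictions\<close>

context uncertain_system
begin

section \<open>Dense sets as the budget for robustness\<close>

lemma solves_finite: "solves w P \<Longrightarrow> finite P"
  using feas_sub[of l u w P] finite_subset[OF _ finite_E] by simp

text \<open>Querying all of \<open>W\<close> costs at most \<open>g\<close> times what a feasible
  set spends inside \<open>W\<close>, whatever the weights outside \<open>Q\<close>. Such bounds add
  up over disjoint sets.\<close>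

definition hit_dense :: "nat \<Rightarrow> ('e \<Rightarrow> real) \<Rightarrow> 'e set \<Rightarrow> 'e set \<Rightarrow> bool" where
  "hit_dense g p Q W \<longleftrightarrow> (\<forall>w P. compat p Q w \<longrightarrow> solves w P \<longrightarrow> card W \<le> g * card (P \<inter> W))"

lemma hit_dense_mono: "hit_dense g p Q W \<Longrightarrow> Q \<subseteq> Q' \<Longrightarrow> hit_dense g p Q' W"
  unfolding hit_dense_def using compat_mono by blast

lemma hit_dense_Un:
  assumes "hit_dense g p Q A" "hit_dense g p Q B'" "A \<inter> B' = {}"
  shows "hit_dense g p Q (A \<union> B')"
  unfolding hit_dense_def
proof (intro allI impI)
  fix w P assume w: "compat p Q w" "solves w P"
  have "card (A \<union> B') \<le> card A + card B'" by (rule card_Un_le)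
  also have "\<dots> \<le> g * (card (P \<inter> A) + card (P \<inter> B'))"
    using assms w unfolding hit_dense_def by (simp add: add_mono distrib_left)
  also have "card (P \<inter> A) + card (P \<inter> B') = card (P \<inter> (A \<union> B'))"
    using solves_finite[OF w(2)] assms(3)
    by (subst card_Un_disjoint[symmetric]) (auto simp: Int_Un_distrib)
  finally show "card (A \<union> B') \<le> g * card (P \<inter> (A \<union> B'))" .
qed

lemma hit_dense_if_meets:
  assumes "card A \<le> g" "\<And>w P. compat p Q w \<Longrightarrow> solves w P \<Longrightarrow> P \<inter> A \<noteq> {}"
  shows "hit_dense g p Q A"
  unfolding hit_dense_def
proof (intro allI impI)
  fix w P assume w: "compat p Q w" "solves w P"
  then have "1 \<le> card (P \<inter> A)" using assms(2)[OF w] solves_finite[OF w(2)]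
    by (simp add: Suc_leI card_gt_0_iff)
  from mult_le_mono2[OF this, of g] have "g \<le> g * card (P \<inter> A)" by (simp only: mult_1_right)
  with assms(1) show "card A \<le> g * card (P \<inter> A)" by (rule order_trans)
qed

text \<open>
  In a trusted plan the revealed weights have so far agreed with \<open>p\<close>; \<open>W\<close> is what is queried in
  total when the next answer turns out to be different.
\<close>

fun trusted_plan :: "nat \<Rightarrow> ('e \<Rightarrow> real) \<Rightarrow> 'e set \<Rightarrow> 'e list \<Rightarrow> bool" where
  "trusted_plan g p Q [] \<longleftrightarrow> solves p Q \<and> (\<exists>W. Q \<subseteq> W \<and> W \<subseteq> E \<and> hit_dense g p Q W)"
| "trusted_plan g p Q (x # xs) \<longleftrightarrow> x \<in> E - Q \<and> (\<exists>W. insert x Q \<subseteq> W \<and> W \<subseteq> E \<and> hit_dense g p Q W) \<and>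
     trusted_plan g p (insert x Q) xs"

text \<open>
  Each \<open>c \<in> R\<close> is the unqueried centre of a star whose leaves \<open>V c\<close> were queried with witness
  partner \<open>c\<close>. When the predictions turn out wrong, querying \<open>c\<close> completes the star.
\<close>

definition stars :: "nat \<Rightarrow> ('e \<Rightarrow> real) \<Rightarrow> 'e set \<Rightarrow> 'e set \<Rightarrow> ('e \<Rightarrow> 'e set) \<Rightarrow> bool" where
  "stars g p Q R V \<longleftrightarrow> R \<subseteq> E - Q \<and> (\<forall>c \<in> R. V c \<subseteq> Q \<and> Suc (card (V c)) \<le> g) \<and>
     disjoint_family_on V R \<and> hit_dense g p Q (Q - \<Union>(V ` R)) \<and>
     (\<forall>c \<in> R. \<forall>w P. compat p Q w \<longrightarrow> solves w P \<longrightarrow> P \<inter> insert c (V c) \<noteq> {})"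

lemma stars_card: "stars g p Q R V \<Longrightarrow> Q \<subseteq> E \<Longrightarrow> c \<in> R \<Longrightarrow>
    card (insert c (V c)) \<le> g"
  using card_insert_le_m1[of g "V c" c] unfolding stars_def by fastforce

text \<open>A completed star has at most \<open>g\<close> elements and meets every feasible set. As
  the stars are disjoint, they can be added one by one to the part of \<open>Q\<close> outside all
  stars.\<close>

lemma stars_hit_dense_part:
  assumes st: "stars g p Q R V" and QE: "Q \<subseteq> E" and A: "A \<subseteq> R"
  shows "hit_dense g p Q ((Q - \<Union>(V ` R)) \<union> (\<Union>c\<in>A. insert c (V c)))"
proof -
  have "finite A" using st A finite_E unfolding stars_def by (meson finite_Diff finite_subset)
  then show ?thesis using A
  proof (induction A rule: finite_induct)
    case empty
    then show ?case using st by (simp add: stars_def)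
  next
    case (insert c A)
    have "hit_dense g p Q (((Q - \<Union>(V ` R)) \<union> (\<Union>c\<in>A. insert c (V c))) \<union> insert c (V c))"
    proof (rule hit_dense_Un)
      show "hit_dense g p Q ((Q - \<Union>(V ` R)) \<union> (\<Union>c\<in>A. insert c (V c)))"
        using insert by blast
      show "hit_dense g p Q (insert c (V c))"
        by (rule hit_dense_if_meets) (use stars_card[OF st QE] st insert.prems in \<open>auto simp: stars_def\<close>)
      show "((Q - \<Union>(V ` R)) \<union> (\<Union>c\<in>A. insert c (V c))) \<inter> insert c (V c) = {}"
      proof -
        have "disjoint_family_on V R" using st by (simp add: stars_def)
        then have "V c \<inter> V a = {}" if "a \<in> A" for a
          using disjoint_family_onD[of V R c a] insert.prems insert.hyps(2) that by auto
        moreover have "a \<notin> V c" "c \<notin> V a" "c \<notin> Q" if "a \<in> A" for a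
          using st insert.prems that unfolding stars_def by blast+
        moreover have "c \<notin> Q" using st insert.prems unfolding stars_def by blast
        ultimately show ?thesis using insert.prems insert.hyps by blast
      qed
    qed
    then show ?case by (simp add: Un_ac)
  qed
qed

lemma stars_hit_dense:
  assumes st: "stars g p Q R V" and QE: "Q \<subseteq> E"
  shows "hit_dense g p Q (Q \<union> R)"
proof -
  have "Q \<union> R = (Q - \<Union>(V ` R)) \<union> (\<Union>c\<in>R. insert c (V c))"
    using st unfolding stars_def by blast
  then show ?thesis using stars_hit_dense_part[OF st QE subset_refl] by simp
qed

text \<open>Leaves out one star so that it can be counted in an enlarged form.\<close>

lemma stars_hit_dense_except:
  assumes st: "stars g p Q R V" and QE: "Q \<subseteq> E" and c: "c \<in> R"
  shows "hit_dense g p Q (Q \<union> R - insert c (V c))"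
proof -
  have VQ: "V a \<subseteq> Q" "a \<notin> Q" if "a \<in> R" for a
    using st that unfolding stars_def by blast+
  have dj: "V a \<inter> V c = {}" if "a \<in> R - {c}" for a
    using st that c unfolding stars_def disjoint_family_on_def by blast
  have "Q \<union> R - insert c (V c) = (Q - \<Union>(V ` R)) \<union> (\<Union>a\<in>R - {c}. insert a (V a))"
    using VQ dj c by blast
  then show ?thesis using stars_hit_dense_part[OF st QE, of "R - {c}"] by simp
qed

text \<open>
  \<open>m\<close> counts the queries that an optimal query set pays for if the predictions are correct;
  \<open>S\<close> contains the elements that may still serve as witness partners.
\<close>

definition invariant :: "nat \<Rightarrow> ('e \<Rightarrow> real) \<Rightarrow> 'e set \<Rightarrow> 'e set \<Rightarrow> nat \<Rightarrow> bool" where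
  "invariant g p S Q m \<longleftrightarrow> Q \<subseteq> E \<and> (\<exists>R V. stars g p Q R V \<and>
     (\<forall>c \<in> R \<inter> S. \<forall>w P. compat p (insert c Q) w \<longrightarrow> solves w P \<longrightarrow> V c \<subseteq> P) \<and>
     g * card Q + (\<Sum>c\<in>R. card (V c)) \<le> Suc g * m)"

section \<open>Preserving the invariant under forced and witness queries\<close>

lemma invariant_hit_dense:
  "invariant g p S Q m \<Longrightarrow> \<exists>W. Q \<subseteq> W \<and> W \<subseteq> E \<and> hit_dense g p Q W"
proof -
  assume "invariant g p S Q m"
  then obtain R V where "Q \<subseteq> E" "stars g p Q R V" unfolding invariant_def by blast
  moreover from this have "R \<subseteq> E" unfolding stars_def by blast
  ultimately show ?thesis using stars_hit_dense[of g p Q R V] by (intro exI[of _ "Q \<union> R"]) auto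
qed

lemma invariant_init: "invariant g p UNIV {} 0"
  unfolding invariant_def
  by (intro conjI exI[of _ "{}"] exI[of _ "\<lambda>_. {}"])
    (auto simp: stars_def hit_dense_def disjoint_family_on_def)

lemma finite_R: "stars g p Q R V \<Longrightarrow> finite R"
  unfolding stars_def using finite_E by (meson finite_Diff finite_subset)

text \<open>A forced element is dense by itself, and of the \<open>g + 1\<close> units gained in the
  count its query spends \<open>g\<close>. If \<open>v\<close> is a centre, the query completes its
  star, which joins the part outside the stars.\<close>

lemma invariant_forced:
  assumes inv: "invariant g p S Q m" and g: "2 \<le> g" and v: "v \<in> E - Q" "forced p Q v"
  shows "invariant g p S (insert v Q) (Suc m)"
    and "trusted_plan g p (insert v Q) xs \<Longrightarrow> trusted_plan g p Q (v # xs)"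
proof -
  obtain R V where QE: "Q \<subseteq> E" and st: "stars g p Q R V"
    and cert: "\<And>c w P. c \<in> R \<inter> S \<Longrightarrow> compat p (insert c Q) w \<Longrightarrow> solves w P \<Longrightarrow> V c \<subseteq> P"
    and cnt: "g * card Q + (\<Sum>c\<in>R. card (V c)) \<le> Suc g * m"
    using inv unfolding invariant_def by blast
  have finQ: "finite Q" using QE finite_E finite_subset by blast
  have R: "R \<subseteq> E - Q" and VQ: "\<And>c. c \<in> R \<Longrightarrow> V c \<subseteq> Q"
    and D: "hit_dense g p Q (Q - \<Union>(V ` R))" using st unfolding stars_def by auto
  let ?Q = "insert v Q" and ?R = "R - {v}"
  have hit: "hit_dense g p Q {v}"
    by (rule hit_dense_if_meets) (use g v in \<open>auto simp: forced_def\<close>)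
  have W: "hit_dense g p Q (Q \<union> R \<union> {v})"
  proof (cases "v \<in> R")
    case True then show ?thesis using stars_hit_dense[OF st QE] by (simp add: insert_absorb)
  next
    case False then show ?thesis using v by (intro hit_dense_Un[OF stars_hit_dense[OF st QE] hit]) auto
  qed
  then show "trusted_plan g p (insert v Q) xs \<Longrightarrow> trusted_plan g p Q (v # xs)"
    using v R QE by (auto intro!: exI[of _ "Q \<union> R \<union> {v}"])
  have D': "hit_dense g p Q (?Q - \<Union>(V ` ?R))"
  proof (cases "v \<in> R")
    case True
    have "?Q - \<Union>(V ` ?R) = (Q - \<Union>(V ` R)) \<union> (\<Union>c\<in>{v}. insert c (V c))"
    proof -
      have "V c \<inter> V v = {}" if "c \<in> ?R" for c
        using st that True unfolding stars_def disjoint_family_on_def by blast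
      then show ?thesis using VQ v True by blast
    qed
    then show ?thesis using stars_hit_dense_part[OF st QE, of "{v}"] True by simp
  next
    case False
    have "?Q - \<Union>(V ` ?R) = (Q - \<Union>(V ` R)) \<union> {v}" using False VQ v by blast
    then show ?thesis using hit_dense_Un[OF D hit] v by auto
  qed
  have "stars g p ?Q ?R V"
    unfolding stars_def
  proof (intro conjI)
    show "hit_dense g p ?Q (?Q - \<Union>(V ` ?R))" by (rule hit_dense_mono[OF D']) auto
    show "disjoint_family_on V ?R" using st unfolding stars_def disjoint_family_on_def by blast
    show "\<forall>c \<in> ?R. \<forall>w P. compat p ?Q w \<longrightarrow> solves w P \<longrightarrow> P \<inter> insert c (V c) \<noteq> {}"
      using st compat_mono[of p ?Q _ Q] unfolding stars_def by blast
  qed (use st in \<open>auto simp: stars_def\<close>)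
  moreover have "\<forall>c \<in> ?R \<inter> S. \<forall>w P. compat p (insert c ?Q) w \<longrightarrow> solves w P \<longrightarrow> V c \<subseteq> P"
    using cert compat_mono by (metis DiffE IntE IntI insert_commute subset_insertI)
  moreover have "g * card ?Q + (\<Sum>c\<in>?R. card (V c)) \<le> Suc g * Suc m"
  proof -
    have "(\<Sum>c\<in>?R. card (V c)) \<le> (\<Sum>c\<in>R. card (V c))"
      using finite_R[OF st] by (intro sum_mono2) auto
    then show ?thesis using cnt finQ v by simp
  qed
  ultimately show "invariant g p S (insert v Q) (Suc m)"
    using QE v unfolding invariant_def by blast
qed

text \<open>Each step earns \<open>g + 1\<close> units in the count. A new leaf spends
  \<open>g\<close> and leaves one unit at its centre \<open>q\<close>; when \<open>g - 1\<close>
  units lie there, the next leaf brings the last one needed to pay for querying \<open>q\<close>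
  too. If \<open>v\<close> is itself a centre, its query completes its star. A partner may stay in
  \<open>S'\<close> only if its predicted value makes \<open>v\<close> mandatory.\<close>

lemma invariant_witness:
  assumes inv: "invariant g p S Q m" and g: "2 \<le> g"
    and vq: "v \<in> E - Q" "q \<in> E - Q" "v \<noteq> q" "q \<in> S" and wit: "witness p Q v q"
    and S': "S' \<subseteq> S" "q \<in> S' \<Longrightarrow> forced p (insert q Q) v"
  shows "\<exists>Q' ys. invariant g p S' Q' (Suc m) \<and> insert v Q \<subseteq> Q' \<and> Q' \<subseteq> insert v (insert q Q) \<and>
    card Q' = card Q + length ys \<and> (\<forall>xs. trusted_plan g p Q' xs \<longrightarrow> trusted_plan g p Q (ys @ xs))"
proof -
  obtain R V where QE: "Q \<subseteq> E" and st: "stars g p Q R V"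
    and cert: "\<And>c w P. c \<in> R \<inter> S \<Longrightarrow> compat p (insert c Q) w \<Longrightarrow> solves w P \<Longrightarrow> V c \<subseteq> P"
    and cnt: "g * card Q + (\<Sum>c\<in>R. card (V c)) \<le> Suc g * m"
    using inv unfolding invariant_def by blast
  have finQ: "finite Q" using QE finite_E finite_subset by blast
  have finR: "finite R" by (rule finite_R[OF st])
  have R: "R \<subseteq> E - Q" and VQ: "\<And>c. c \<in> R \<Longrightarrow> V c \<subseteq> Q" and Vg: "\<And>c. c \<in> R \<Longrightarrow> Suc (card (V c)) \<le> g"
    and D: "hit_dense g p Q (Q - \<Union>(V ` R))"
    and hit: "\<And>c w P. c \<in> R \<Longrightarrow> compat p Q w \<Longrightarrow> solves w P \<Longrightarrow> P \<inter> insert c (V c) \<noteq> {}"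
    and dj: "\<And>c d. c \<in> R \<Longrightarrow> d \<in> R \<Longrightarrow> c \<noteq> d \<Longrightarrow> V c \<inter> V d = {}"
    using st unfolding stars_def disjoint_family_on_def by auto
  have finV: "finite (V c)" if "c \<in> R" for c using VQ[OF that] finQ finite_subset by blast
  have vqP: "v \<in> P \<or> q \<in> P" if "compat p Q w" "solves w P" for w P
    using wit that unfolding witness_def by blast
  consider (centre) "v \<in> R" | (new) "v \<notin> R" "q \<notin> R"
    | (add) "v \<notin> R" "q \<in> R" "Suc (Suc (card (V q))) \<le> g"
    | (full) "v \<notin> R" "q \<in> R" "Suc (card (V q)) = g" using Vg[of q] by force
  then show ?thesis
  proof cases
    case centre
    let ?Q = "insert v Q" and ?R = "R - {v}"
    have "?Q - \<Union>(V ` ?R) = (Q - \<Union>(V ` R)) \<union> (\<Union>c\<in>{v}. insert c (V c))"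
      using dj[OF _ centre] VQ vq(1) centre by blast
    then have D': "hit_dense g p Q (?Q - \<Union>(V ` ?R))"
      using stars_hit_dense_part[OF st QE, of "{v}"] centre by simp
    have "stars g p ?Q ?R V"
      unfolding stars_def
    proof (intro conjI)
      show "hit_dense g p ?Q (?Q - \<Union>(V ` ?R))" by (rule hit_dense_mono[OF D']) auto
      show "disjoint_family_on V ?R" using dj unfolding disjoint_family_on_def by blast
      show "\<forall>c \<in> ?R. \<forall>w P. compat p ?Q w \<longrightarrow> solves w P \<longrightarrow> P \<inter> insert c (V c) \<noteq> {}"
        using hit compat_mono[of p ?Q _ Q] by blast
    qed (use VQ Vg R in auto)
    moreover have "\<forall>c \<in> ?R \<inter> S'. \<forall>w P. compat p (insert c ?Q) w \<longrightarrow> solves w P \<longrightarrow> V c \<subseteq> P"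
      using cert S'(1) compat_mono
        by (metis (no_types, lifting) DiffE IntE IntI insert_commute subsetD subset_insertI)
    moreover have "g * card ?Q + (\<Sum>c\<in>?R. card (V c)) \<le> Suc g * Suc m"
    proof -
      have "(\<Sum>c\<in>?R. card (V c)) \<le> (\<Sum>c\<in>R. card (V c))"
        using finR by (intro sum_mono2) auto
      then show ?thesis using cnt finQ vq by simp
    qed
    ultimately have "invariant g p S' ?Q (Suc m)" using QE vq unfolding invariant_def by blast
    moreover have "trusted_plan g p Q ([v] @ xs)" if "trusted_plan g p ?Q xs" for xs
      using that vq R QE stars_hit_dense[OF st QE] centre by (auto intro!: exI[of _ "Q \<union> R"])
    moreover have "card ?Q = card Q + length [v]" using finQ vq by simp
    ultimately show ?thesis by (intro exI[of _ ?Q] exI[of _ "[v]"]) auto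
  next
    case new
    let ?Q = "insert v Q" and ?R = "insert q R" and ?V = "V(q := {v})"
    have V': "?V c = V c" if "c \<in> R" for c using that new by auto
    have "(\<Union>c\<in>R. ?V c) = (\<Union>c\<in>R. V c)" by (rule SUP_cong) (use V' in auto)
    moreover have "\<Union>(?V ` ?R) = ?V q \<union> (\<Union>c\<in>R. ?V c)" by (simp only: UN_insert)
    ultimately have "\<Union>(?V ` ?R) = insert v (\<Union>(V ` R))"
      by (simp only: fun_upd_same insert_is_Un[symmetric])
    then have "?Q - \<Union>(?V ` ?R) = Q - \<Union>(V ` R)" using vq by auto
    then have D': "hit_dense g p ?Q (?Q - \<Union>(?V ` ?R))" using hit_dense_mono[OF D, of ?Q] by auto
    have "stars g p ?Q ?R ?V"
      unfolding stars_def
    proof (intro conjI)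
      show "disjoint_family_on ?V ?R"
        using dj VQ vq V' unfolding disjoint_family_on_def by (auto; blast)
      show "\<forall>c \<in> ?R. \<forall>w P. compat p ?Q w \<longrightarrow> solves w P \<longrightarrow> P \<inter> insert c (?V c) \<noteq> {}"
        using hit compat_mono[of p ?Q _ Q] vqP by (auto; blast)
      show "\<forall>c \<in> ?R. ?V c \<subseteq> ?Q \<and> Suc (card (?V c)) \<le> g"
        using VQ Vg g by auto
    qed (use R D' vq new in auto)
    moreover have "\<forall>c \<in> ?R \<inter> S'. \<forall>w P. compat p (insert c ?Q) w \<longrightarrow> solves w P \<longrightarrow> ?V c \<subseteq> P"
    proof (intro ballI allI impI)
      fix c w P assume c: "c \<in> ?R \<inter> S'" "compat p (insert c ?Q) w" "solves w P"
      then have cw: "compat p (insert c Q) w"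
        using compat_mono[of p "insert c ?Q" w "insert c Q"] by blast
      show "?V c \<subseteq> P"
      proof (cases "c = q")
        case True then show ?thesis using S'(2) c cw by (auto simp: forced_def)
      next
        case False then show ?thesis using cert[of c w P] c cw S'(1) by auto
      qed
    qed
    moreover have "g * card ?Q + (\<Sum>c\<in>?R. card (?V c)) \<le> Suc g * Suc m"
    proof -
      have "(\<Sum>c\<in>?R. card (?V c)) = 1 + (\<Sum>c\<in>R. card (?V c))" using finR new by simp
      also have "(\<Sum>c\<in>R. card (?V c)) = (\<Sum>c\<in>R. card (V c))" using V' by simp
      finally show ?thesis using cnt finQ vq by simp
    qed
    ultimately have "invariant g p S' ?Q (Suc m)" using QE vq unfolding invariant_def by blast
    moreover have "trusted_plan g p Q ([v] @ xs)" if "trusted_plan g p ?Q xs" for xs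
    proof -
      have "hit_dense g p Q {v, q}" by (rule hit_dense_if_meets) (use g vq vqP in auto)
      then have "hit_dense g p Q (Q \<union> R \<union> {v, q})"
        using vq new by (intro hit_dense_Un[OF stars_hit_dense[OF st QE]]) auto
      then show ?thesis using that vq R QE by (auto intro!: exI[of _ "Q \<union> R \<union> {v, q}"])
    qed
    moreover have "card ?Q = card Q + length [v]" using finQ vq by simp
    ultimately show ?thesis by (intro exI[of _ ?Q] exI[of _ "[v]"]) auto
  next
    case add
    let ?Q = "insert v Q" and ?V = "V(q := insert v (V q))"
    have vV: "v \<notin> V c" if "c \<in> R" for c using VQ[OF that] vq by blast
    have "?Q - \<Union>(?V ` R) = Q - \<Union>(V ` R)"
      using add(2) vq(1) vV by (auto split: if_splits)
    then have D': "hit_dense g p ?Q (?Q - \<Union>(?V ` R))" using hit_dense_mono[OF D, of ?Q] by auto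
    have cV: "card (?V q) = Suc (card (V q))" using finV vV add by simp
    have "stars g p ?Q R ?V"
      unfolding stars_def
    proof (intro conjI)
      show "disjoint_family_on ?V R"
        unfolding disjoint_family_on_def
      proof (intro ballI impI)
        fix c d assume "c \<in> R" "d \<in> R" "c \<noteq> d"
        then show "?V c \<inter> ?V d = {}" using dj[of c d] vV[of c] vV[of d] by auto
      qed
      show "\<forall>c \<in> R. \<forall>w P. compat p ?Q w \<longrightarrow> solves w P \<longrightarrow> P \<inter> insert c (?V c) \<noteq> {}"
      proof (intro ballI allI impI)
        fix c w P assume "c \<in> R" "compat p ?Q w" "solves w P"
        then show "P \<inter> insert c (?V c) \<noteq> {}"
          using hit[of c w P] compat_mono[of p ?Q w Q] by auto
      qed
      show "\<forall>c \<in> R. ?V c \<subseteq> ?Q \<and> Suc (card (?V c)) \<le> g"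
        using VQ Vg add cV by (auto simp del: fun_upd_apply) (auto split: if_splits)
    qed (use R D' vq add in auto)
    moreover have "\<forall>c \<in> R \<inter> S'. \<forall>w P. compat p (insert c ?Q) w \<longrightarrow> solves w P \<longrightarrow> ?V c \<subseteq> P"
    proof (intro ballI allI impI)
      fix c w P assume c: "c \<in> R \<inter> S'" "compat p (insert c ?Q) w" "solves w P"
      then have cw: "compat p (insert c Q) w"
        using compat_mono[of p "insert c ?Q" w "insert c Q"] by blast
      then have "V c \<subseteq> P" using cert[of c w P] c S'(1) by auto
      then show "?V c \<subseteq> P" using S'(2) c cw by (auto simp: forced_def)
    qed
    moreover have "g * card ?Q + (\<Sum>c\<in>R. card (?V c)) \<le> Suc g * Suc m"
    proof -
      have "(\<Sum>c\<in>R. card (?V c)) = card (?V q) + (\<Sum>c\<in>R - {q}. card (?V c))"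
        using finR add by (intro sum.remove) auto
      also have "(\<Sum>c\<in>R - {q}. card (?V c)) = (\<Sum>c\<in>R - {q}. card (V c))"
        by (intro sum.cong) auto
      also have "card (?V q) + \<dots> = Suc (card (V q) + (\<Sum>c\<in>R - {q}. card (V c)))"
        using cV by simp
      also have "card (V q) + (\<Sum>c\<in>R - {q}. card (V c)) = (\<Sum>c\<in>R. card (V c))"
        using finR add by (intro sum.remove[symmetric]) auto
      finally show ?thesis using cnt finQ vq by simp
    qed
    ultimately have "invariant g p S' ?Q (Suc m)" using QE vq unfolding invariant_def by blast
    moreover have "trusted_plan g p Q ([v] @ xs)" if "trusted_plan g p ?Q xs" for xs
    proof -
      have "card (insert v (insert q (V q))) \<le> g"
        using add card_insert_le_m1[of g "insert q (V q)" v] card_insert_le_m1[of "g - 1" "V q" q] g by auto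
      then have "hit_dense g p Q (insert v (insert q (V q)))"
        by (intro hit_dense_if_meets) (use hit[OF add(2)] in auto)
      then have "hit_dense g p Q ((Q \<union> R - insert q (V q)) \<union> insert v (insert q (V q)))"
        using vq add by (intro hit_dense_Un[OF stars_hit_dense_except[OF st QE add(2)]]) auto
      also have "(Q \<union> R - insert q (V q)) \<union> insert v (insert q (V q)) = Q \<union> R \<union> {v}"
        using VQ[OF add(2)] add(2) by blast
      finally show ?thesis using that vq R QE by (auto intro!: exI[of _ "Q \<union> R \<union> {v}"])
    qed
    moreover have "card ?Q = card Q + length [v]" using finQ vq by simp
    ultimately show ?thesis by (intro exI[of _ ?Q] exI[of _ "[v]"]) auto
  next
    case full
    let ?Q1 = "insert q Q" and ?Q = "insert v (insert q Q)" and ?R = "R - {q}"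
    let ?A = "insert v (insert q (V q))"
    \<comment> \<open>Once \<open>q\<close> is revealed as predicted, its \<open>g - 1\<close>
      leaves are mandatory, and \<open>v\<close> or \<open>q\<close> is hit as well, so a feasible
      set contains at least \<open>g\<close> of these \<open>g + 1\<close> elements. Density follows
      from \<open>g + 1 \<le> g * g\<close>.\<close>
    have A: "hit_dense g p ?Q1 ?A"
      unfolding hit_dense_def
    proof (intro allI impI)
      fix w P assume w: "compat p ?Q1 w" "solves w P"
      have "V q \<subseteq> P" using cert[of q w P] full w vq by auto
      moreover have "v \<in> P \<or> q \<in> P" using vqP[of w P] w compat_mono[of p ?Q1 w Q] by auto
      ultimately obtain x where x: "x \<in> {v, q}" "insert x (V q) \<subseteq> P \<inter> ?A" by blast
      have "v \<notin> V q" "q \<notin> V q" using VQ[OF full(2)] vq by auto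
      then have "card (insert x (V q)) = g" using x(1) finV[OF full(2)] full by auto
      moreover have "card (insert x (V q)) \<le> card (P \<inter> ?A)"
        using x(2) solves_finite[OF w(2)] by (intro card_mono) auto
      ultimately have "g * g \<le> g * card (P \<inter> ?A)" by (intro mult_le_mono2) simp
      moreover have "card ?A \<le> Suc g"
        using \<open>v \<notin> V q\<close> \<open>q \<notin> V q\<close> finV[OF full(2)] full vq by simp
      moreover have "Suc g \<le> g * g" using mult_le_mono1[OF g, of g] g by linarith
      ultimately show "card ?A \<le> g * card (P \<inter> ?A)" by linarith
    qed
    have "hit_dense g p ?Q1 ((Q - \<Union>(V ` R)) \<union> ?A)"
      using vq full VQ by (intro hit_dense_Un[OF hit_dense_mono[OF D] A]) auto
    moreover have "?Q - \<Union>(V ` ?R) = (Q - \<Union>(V ` R)) \<union> ?A"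
      using dj[OF _ full(2)] VQ vq full by blast
    ultimately have D': "hit_dense g p ?Q (?Q - \<Union>(V ` ?R))"
      using hit_dense_mono[of g p ?Q1 _ ?Q] by auto
    have "stars g p ?Q ?R V"
      unfolding stars_def
    proof (intro conjI)
      show "disjoint_family_on V ?R" using dj unfolding disjoint_family_on_def by blast
      show "\<forall>c \<in> ?R. \<forall>w P. compat p ?Q w \<longrightarrow> solves w P \<longrightarrow> P \<inter> insert c (V c) \<noteq> {}"
        using hit compat_mono[of p ?Q _ Q] by blast
    qed (use VQ Vg R D' full in auto)
    moreover have "\<forall>c \<in> ?R \<inter> S'. \<forall>w P. compat p (insert c ?Q) w \<longrightarrow> solves w P \<longrightarrow> V c \<subseteq> P"
    proof (intro ballI allI impI)
      fix c w P assume c: "c \<in> ?R \<inter> S'" "compat p (insert c ?Q) w" "solves w P"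
      then have cw: "compat p (insert c Q) w"
        using compat_mono[of p "insert c ?Q" w "insert c Q"] by blast
      then show "V c \<subseteq> P" using cert[of c w P] c S'(1) by auto
    qed
    moreover have "g * card ?Q + (\<Sum>c\<in>?R. card (V c)) \<le> Suc g * Suc m"
    proof -
      have "(\<Sum>c\<in>R. card (V c)) = card (V q) + (\<Sum>c\<in>?R. card (V c))"
        using finR full by (intro sum.remove) auto
      moreover have "card ?Q = Suc (Suc (card Q))" using finQ vq by simp
      ultimately show ?thesis using cnt full(3) by simp
    qed
    ultimately have "invariant g p S' ?Q (Suc m)" using QE vq unfolding invariant_def by blast
    \<comment> \<open>The centre comes first: the set to complete is \<open>Q \<union> R\<close> if
      \<open>q\<close> deviates, and the density of \<open>?A\<close> is available when
      \<open>v\<close> is queried.\<close>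
    moreover have "trusted_plan g p Q ([q, v] @ xs)" if "trusted_plan g p ?Q xs" for xs
    proof -
      have "hit_dense g p ?Q1 ((Q \<union> R - insert q (V q)) \<union> ?A)"
        using vq full
          by (intro hit_dense_Un[OF hit_dense_mono[OF stars_hit_dense_except[OF st QE full(2)]] A]) auto
      also have "(Q \<union> R - insert q (V q)) \<union> ?A = Q \<union> R \<union> {v}"
        using VQ[OF full(2)] full(2) by blast
      finally have "trusted_plan g p ?Q1 (v # xs)"
        using that vq R QE full by (auto intro!: exI[of _ "Q \<union> R \<union> {v}"])
      then show ?thesis
        using vq R QE full stars_hit_dense[OF st QE] by (auto intro!: exI[of _ "Q \<union> R"])
    qed
    moreover have "card ?Q = card Q + length [q, v]" using finQ vq by simp
    ultimately show ?thesis by (intro exI[of _ ?Q] exI[of _ "[q, v]"]) auto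
  qed
qed

text \<open>\<open>Q\<close> may exceed \<open>Q0\<close> by centres queried on the way; witness
  pairs survive additional knowledge. Since the partners are distinct, each is dropped from
  \<open>S\<close> after its turn.\<close>

lemma trusted_plan_from_witness_plan:
  assumes p: "realization l u p" and g: "2 \<le> g"
    and "invariant g p S Q m" "witness_plan p Q0 ps" "Q0 \<subseteq> Q" "distinct (map fst ps @ map snd ps)"
    and "set (map fst ps @ map snd ps) \<subseteq> E - Q" "set (map snd ps) \<subseteq> S"
  shows "\<exists>xs. trusted_plan g p Q xs \<and> g * (card Q + length xs) \<le> Suc g * (m + length ps)"
  using assms(3-)
proof (induction ps arbitrary: S Q Q0 m)
  case Nil
  have "Q \<subseteq> E" using Nil(1) by (simp add: invariant_def)
  then have "solves p Q" using Nil feas_mono[of l u p Q0 Q] p by simp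
  then have "trusted_plan g p Q []" using invariant_hit_dense[OF Nil(1)] by simp
  moreover have "g * card Q \<le> Suc g * m" using Nil(1) unfolding invariant_def by linarith
  ultimately show ?case by (intro exI[of _ "[]"]) simp
next
  case (Cons vq ps)
  obtain v q where vq: "vq = (v, q)" by force
  have wit: "witness p Q v q"
    using Cons.prems(2,3) compat_mono unfolding vq by (simp add: witness_def) blast
  obtain Q' ys where Q': "invariant g p (S - {q}) Q' (Suc m)" "insert v Q \<subseteq> Q'"
      "Q' \<subseteq> insert v (insert q Q)" "card Q' = card Q + length ys"
      "\<And>xs. trusted_plan g p Q' xs \<Longrightarrow> trusted_plan g p Q (ys @ xs)"
    using invariant_witness[OF Cons.prems(1) g _ _ _ _ wit, of "S - {q}"] Cons.prems(4-6) vq by auto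
  have "\<exists>xs. trusted_plan g p Q' xs \<and> g * (card Q' + length xs) \<le> Suc g * (Suc m + length ps)"
  proof (rule Cons.IH[OF Q'(1)])
    show "witness_plan p (insert v Q0) ps" using Cons.prems(2) vq by simp
    show "insert v Q0 \<subseteq> Q'" using Cons.prems(3) Q'(2) by blast
    show "distinct (map fst ps @ map snd ps)" using Cons.prems(4) by auto
    show "set (map fst ps @ map snd ps) \<subseteq> E - Q'"
    proof -
      have "v \<notin> set (map fst ps @ map snd ps)" "q \<notin> set (map fst ps @ map snd ps)"
        using Cons.prems(4) unfolding vq by auto
      moreover have "set (map fst ps @ map snd ps) \<subseteq> E - Q" using Cons.prems(5) by auto
      ultimately show ?thesis using Q'(3) by blast
    qed
    show "set (map snd ps) \<subseteq> S - {q}" using Cons.prems(4,6) vq by auto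
  qed
  then obtain xs where "trusted_plan g p Q' xs"
    "g * (card Q' + length xs) \<le> Suc g * (Suc m + length ps)" by blast
  then show ?case using Q'(4,5) by (intro exI[of _ "ys @ xs"]) (simp add: add_ac)
qed

text \<open>The pairs are disjoint and, for weights as predicted, each contains an element of
  \<open>P\<close>.\<close>

lemma witness_plan_lower_bound:
  assumes "realization l u p" "solves p P" "witness_plan p Q ps" "distinct (map fst ps @ map snd ps)"
  shows "length ps \<le> card (P \<inter> set (map fst ps @ map snd ps))"
  using assms(3,4)
proof (induction ps arbitrary: Q)
  case (Cons vq ps)
  obtain v q where vq: "vq = (v, q)" by force
  have "v \<in> P \<or> q \<in> P"
    using Cons.prems(1) assms(1,2) compat_self unfolding vq by (auto simp: witness_def)
  then obtain x where x: "x \<in> {v, q}" "x \<in> P" by blast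
  let ?A = "P \<inter> set (map fst ps @ map snd ps)"
  have fin: "finite P" using solves_finite assms(2) by blast
  have "Suc (length ps) \<le> Suc (card ?A)" using Cons vq by auto
  also have "\<dots> = card (insert x ?A)" using x Cons.prems(2) vq fin
    by (subst card_insert_disjoint) auto
  also have "\<dots> \<le> card (P \<inter> set (map fst (vq # ps) @ map snd (vq # ps)))"
    using x vq fin by (intro card_mono) auto
  finally show ?case by simp
qed simp

text \<open>\<open>M\<close> collects elements that every feasible set for the predicted weights
  contains, and \<open>card M\<close> is the count of the invariant. Forced and predicted mandatory
  elements enlarge \<open>M\<close>; the pairs of the final vertex cover are disjoint from
  \<open>M\<close>, so both lower bounds add up.\<close>

lemma ex_trusted_plan:
  assumes p: "realization l u p" and g: "2 \<le> g"
    and "invariant g p UNIV Q (card M)" "M \<subseteq> Q" "\<And>P. solves p P \<Longrightarrow> M \<subseteq> P"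
  shows "\<exists>xs. trusted_plan g p Q xs \<and>
    (\<forall>P. solves p P \<longrightarrow> g * (card Q + length xs) \<le> Suc g * card P)"
  using assms(3-)
proof (induction "card (E - Q)" arbitrary: Q M rule: less_induct)
  case less
  note inv = less.prems(1) and MQ = less.prems(2) and MP = less.prems(3)
  have QE: "Q \<subseteq> E" using inv by (simp add: invariant_def)
  have finM: "finite M" using MQ QE finite_E by (meson finite_subset)
  have card_less: "card (E - Q') < card (E - Q)" if "insert v Q \<subseteq> Q'" "v \<in> E - Q" for v Q'
    using that finite_E by (intro psubset_card_mono) auto
  have IH: "\<exists>xs. trusted_plan g p Q' xs \<and>
      (\<forall>P. solves p P \<longrightarrow> g * (card Q' + length xs) \<le> Suc g * card P)"
    if "insert v Q \<subseteq> Q'" "v \<in> E - Q" "\<And>P. solves p P \<Longrightarrow> v \<in> P"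
      "invariant g p UNIV Q' (Suc (card M))" for v Q'
  proof (rule less.hyps[OF card_less[OF that(1,2)]])
    have "v \<notin> M" using that MQ by blast
    then show "invariant g p UNIV Q' (card (insert v M))" using that(4) finM by simp
  qed (use that MQ MP in auto)
  show ?case
  proof (rule next_query[OF p QE])
    assume "solves p Q"
    then have "trusted_plan g p Q []" using invariant_hit_dense[OF inv] by simp
    moreover have "g * card Q \<le> Suc g * card P" if "solves p P" for P
    proof -
      have "card M \<le> card P" using MP[OF that] solves_finite[OF that] by (rule card_mono[rotated])
      then have "Suc g * card M \<le> Suc g * card P" by (rule mult_le_mono2)
      moreover have "g * card Q \<le> Suc g * card M" using inv unfolding invariant_def by linarith
      ultimately show ?thesis by linarith
    qed
    ultimately show ?thesis by (intro exI[of _ "[]"]) simp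
  next
    fix v assume v: "v \<in> E - Q" "forced p Q v"
    have "v \<in> P" if "solves p P" for P using v(2) that compat_self[OF p] by (auto simp: forced_def)
    then obtain xs where "trusted_plan g p (insert v Q) xs"
      "\<And>P. solves p P \<Longrightarrow> g * (card (insert v Q) + length xs) \<le> Suc g * card P"
      using IH[OF subset_refl v(1) _ invariant_forced(1)[OF inv g v]] by blast
    moreover have "card (insert v Q) = Suc (card Q)"
      using v QE finite_E by (meson DiffD2 card_insert_disjoint finite_subset)
    ultimately show ?thesis
      using invariant_forced(2)[OF inv g v] by (intro exI[of _ "v # xs"]) simp
  next
    fix v q assume v: "v \<in> E - Q" "q \<in> E - Q" "v \<noteq> q" "witness p Q v q" "forced p (insert q Q) v"
    obtain Q' ys where Q': "invariant g p UNIV Q' (Suc (card M))" "insert v Q \<subseteq> Q'"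
        "card Q' = card Q + length ys"
        "\<And>xs. trusted_plan g p Q' xs \<Longrightarrow> trusted_plan g p Q (ys @ xs)"
      using invariant_witness[OF inv g v(1-3) UNIV_I v(4) subset_UNIV v(5)] by blast
    have "v \<in> P" if "solves p P" for P using v(5) that compat_self[OF p] by (auto simp: forced_def)
    then obtain xs where "trusted_plan g p Q' xs"
      "\<And>P. solves p P \<Longrightarrow> g * (card Q' + length xs) \<le> Suc g * card P"
      using IH[OF Q'(2) v(1) _ Q'(1)] by blast
    then show ?thesis using Q'(3,4) by (intro exI[of _ "ys @ xs"]) (simp add: add_ac)
  next
    fix ps assume ps: "witness_plan p Q ps" "distinct (map fst ps @ map snd ps)"
      "set (map fst ps @ map snd ps) \<subseteq> E - Q"
    obtain xs where xs: "trusted_plan g p Q xs"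
      "g * (card Q + length xs) \<le> Suc g * (card M + length ps)"
      using trusted_plan_from_witness_plan[OF p g inv ps(1) subset_refl ps(2,3)] by auto
    have "g * (card Q + length xs) \<le> Suc g * card P" if P: "solves p P" for P
    proof -
      let ?A = "P \<inter> set (map fst ps @ map snd ps)"
      have fin: "finite P" using solves_finite P by blast
      have "card M + length ps \<le> card M + card ?A"
        using witness_plan_lower_bound[OF p P ps(1,2)] by simp
      also have "\<dots> = card (M \<union> ?A)"
        using finM fin MQ ps(3) by (intro card_Un_disjoint[symmetric]) auto
      also have "\<dots> \<le> card P" using fin MP[OF P] by (intro card_mono) auto
      finally have "Suc g * (card M + length ps) \<le> Suc g * card P" by (rule mult_le_mono2)
      then show ?thesis using xs(2) by linarith
    qed
    then show ?thesis using xs(1) by blast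
  qed
qed

section \<open>The prediction-free two-competitive method\<close>

lemma ex_witness:
  assumes "realization l u p" "Q \<subseteq> E" "\<not> solves p Q"
  shows "\<exists>v \<in> E - Q. \<exists>q \<in> E - Q. witness p Q v q"
proof (rule next_query[OF assms(1,2)])
  fix v assume "v \<in> E - Q" "forced p Q v"
  then show ?thesis by (auto simp: forced_def witness_def)
next
  fix ps assume ps: "witness_plan p Q ps" "set (map fst ps @ map snd ps) \<subseteq> E - Q"
  then obtain v q ps' where "ps = (v, q) # ps'" using assms(3) by (cases ps) auto
  then show ?thesis using ps by auto
qed (use assms in auto)

text \<open>The queries are charged to \<open>P - Q\<close> only, so the bound can be added to one
  for the set \<open>Q\<close> already queried.\<close>

definition two_competitive :: "('e \<Rightarrow> real) \<Rightarrow> 'e set \<Rightarrow> 'e dtree \<Rightarrow> bool" where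
  "two_competitive p Q t \<longleftrightarrow> (\<forall>w. compat p Q w \<longrightarrow> distinct (run t w) \<and> set (run t w) \<subseteq> E - Q \<and>
    solves w (Q \<union> set (run t w)) \<and> (\<forall>P. solves w P \<longrightarrow> length (run t w) \<le> 2 * card (P - Q)))"

text \<open>Both elements of a witness pair are queried, and each round removes at least one element
  from \<open>P - Q\<close>. Here \<open>p\<close> serves to record the answers.\<close>

lemma ex_two_competitive:
  assumes "realization l u p" "Q \<subseteq> E"
  shows "\<exists>t. two_competitive p Q t"
  using assms
proof (induction "card (E - Q)" arbitrary: Q p rule: less_induct)
  case less
  show ?case
  proof (cases "solves p Q")
    case True
    have "solves w Q" if "compat p Q w" for w
      using True that feas_cong[of Q w p l u] by (auto simp: compat_def)
    then show ?thesis by (intro exI[of _ Stop]) (simp add: two_competitive_def)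
  next
    case False
    then obtain v q where vq: "v \<in> E - Q" "q \<in> E - Q" "witness p Q v q"
      using ex_witness less.prems by blast
    \<comment> \<open>The pair may be degenerate: a mandatory element is its own partner.\<close>
    define ys where "ys = remdups [v, q]"
    have ys: "distinct ys" "set ys = {v, q}" "length ys \<le> 2" by (auto simp: ys_def)
    let ?Q = "Q \<union> set ys"
    have "card (E - ?Q) < card (E - Q)"
      using vq ys finite_E by (intro psubset_card_mono) auto
    then have "\<forall>p'. \<exists>t. realization l u p' \<longrightarrow> two_competitive p' ?Q t"
      using less.hyps[of ?Q] less.prems(2) vq ys(2) by auto
    then obtain f where f: "\<And>p'. realization l u p' \<Longrightarrow> two_competitive p' ?Q (f p')" by metis
    show ?thesis unfolding two_competitive_def
    proof (intro exI[of _ "query_all ys f p"] allI impI)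
      fix w assume w: "compat p Q w"
      define p' where "p' = (\<lambda>e. if e \<in> set ys then w e else p e)"
      have r: "run (query_all ys f p) w = ys @ run (f p') w"
        by (simp add: run_query_all p'_def)
      have p': "realization l u p'" "compat p' ?Q w"
        using w less.prems by (auto simp: p'_def compat_def realization_def)
      note fp = f[OF p'(1), unfolded two_competitive_def, rule_format, OF p'(2)]
      have "length ys + length (run (f p') w) \<le> 2 * card (P - Q)" if P: "solves w P" for P
      proof -
        have "v \<in> P \<or> q \<in> P" using vq(3) w P by (auto simp: witness_def)
        then have "P - ?Q \<subset> P - Q" using vq ys by auto
        then have "card (P - ?Q) < card (P - Q)"
          using solves_finite[OF P] by (intro psubset_card_mono) auto
        moreover have "length (run (f p') w) \<le> 2 * card (P - ?Q)" using fp P by blast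
        ultimately show ?thesis using ys(3) by linarith
      qed
      moreover have "distinct (ys @ run (f p') w)" using fp ys by auto
      moreover have "set (ys @ run (f p') w) \<subseteq> E - Q" using fp ys vq by auto
      moreover have "solves w (Q \<union> set (ys @ run (f p') w))" using fp by (simp add: Un_assoc)
      ultimately show "distinct (run (query_all ys f p) w) \<and> set (run (query_all ys f p) w) \<subseteq> E - Q \<and>
        solves w (Q \<union> set (run (query_all ys f p) w)) \<and>
        (\<forall>P. solves w P \<longrightarrow> length (run (query_all ys f p) w) \<le> 2 * card (P - Q))"
        unfolding r by simp
    qed
  qed
qed

text \<open>The tree follows \<open>xs\<close> while the answers agree with \<open>p\<close>. At the
  first deviation it queries the rest of \<open>W\<close> and then turns to the two-competitive
  method. The density of \<open>W\<close> was established before the answer for \<open>x\<close>, so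
  it holds for the deviating answer too.\<close>

lemma trusted_plan_tree:
  assumes p: "realization l u p" and g: "2 \<le> g" and "Q \<subseteq> E" "trusted_plan g p Q xs"
  shows "\<exists>t. \<forall>w. compat p Q w \<longrightarrow> distinct (run t w) \<and> set (run t w) \<subseteq> E - Q \<and>
    solves w (Q \<union> set (run t w)) \<and>
    (\<forall>P. solves w P \<longrightarrow> card Q + length (run t w) \<le> g * card P) \<and>
    ((\<forall>e \<in> E. w e = p e) \<longrightarrow> run t w = xs)"
  using assms(3-)
proof (induction xs arbitrary: Q)
  case Nil
  then obtain W where W: "solves p Q" "Q \<subseteq> W" "W \<subseteq> E" "hit_dense g p Q W" by auto
  show ?case
  proof (intro exI[of _ Stop] allI impI)
    fix w assume w: "compat p Q w"
    have "solves w Q" using W(1) w feas_cong[of Q w p l u] by (auto simp: compat_def)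
    moreover have "card Q \<le> g * card P" if P: "solves w P" for P
    proof -
      have "card Q \<le> card W" using W finite_E by (meson card_mono finite_subset)
      also have "\<dots> \<le> g * card (P \<inter> W)" using W(4) w P unfolding hit_dense_def by blast
      also have "\<dots> \<le> g * card P" using solves_finite[OF P]
        by (intro mult_le_mono2 card_mono) auto
      finally show ?thesis .
    qed
    ultimately show "distinct (run Stop w) \<and> set (run Stop w) \<subseteq> E - Q \<and>
      solves w (Q \<union> set (run Stop w)) \<and>
      (\<forall>P. solves w P \<longrightarrow> card Q + length (run Stop w) \<le> g * card P) \<and>
      ((\<forall>e \<in> E. w e = p e) \<longrightarrow> run Stop w = [])" by simp
  qed
next
  case (Cons x xs)
  then obtain W where W: "insert x Q \<subseteq> W" "W \<subseteq> E" "hit_dense g p Q W" and x: "x \<in> E - Q"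
    and plan: "trusted_plan g p (insert x Q) xs" by auto
  have finQ: "finite Q" and finW: "finite W" using Cons.prems(1) W(2) finite_E finite_subset by blast+
  obtain t' where t': "\<And>w. compat p (insert x Q) w \<Longrightarrow> distinct (run t' w) \<and>
    set (run t' w) \<subseteq> E - insert x Q \<and> solves w (insert x Q \<union> set (run t' w)) \<and>
    (\<forall>P. solves w P \<longrightarrow> card (insert x Q) + length (run t' w) \<le> g * card P) \<and>
    ((\<forall>e \<in> E. w e = p e) \<longrightarrow> run t' w = xs)"
    using Cons.IH[OF _ plan] x Cons.prems(1) by blast
  obtain f where f: "\<And>p'. realization l u p' \<Longrightarrow> two_competitive p' W (f p')"
    using ex_two_competitive[OF _ W(2)] by metis
  obtain ys where ys: "distinct ys" "set ys = W - insert x Q"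
    using finite_distinct_list[of "W - insert x Q"] finW by auto
  define t where "t = Query x (\<lambda>r. if r = p x then t' else query_all ys f (p(x := r)))"
  show ?case
  proof (intro exI[of _ t] allI impI)
    fix w assume w: "compat p Q w"
    show "distinct (run t w) \<and> set (run t w) \<subseteq> E - Q \<and> solves w (Q \<union> set (run t w)) \<and>
      (\<forall>P. solves w P \<longrightarrow> card Q + length (run t w) \<le> g * card P) \<and>
      ((\<forall>e \<in> E. w e = p e) \<longrightarrow> run t w = x # xs)"
    proof (cases "w x = p x")
      case True
      then have r: "run t w = x # run t' w" by (simp add: t_def)
      have "compat p (insert x Q) w" using w True by (auto simp: compat_def)
      from t'[OF this] show ?thesis using x finQ unfolding r by auto
    next
      case False
      define p' where "p' = (\<lambda>e. if e \<in> set ys then w e else (p(x := w x)) e)"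
      have r: "run t w = x # ys @ run (f p') w" using False by (simp add: t_def run_query_all p'_def)
      have p': "realization l u p'" "compat p' W w"
        using w p ys W x by (auto simp: p'_def compat_def realization_def)
      note fp = f[OF p'(1), unfolded two_competitive_def, rule_format, OF p'(2)]
      have cW: "Q \<union> insert x (set ys) = W" using ys W by auto
      have "Q \<inter> insert x (set ys) = {}" using x ys by auto
      from card_Un_disjoint[OF finQ _ this] have "card W = card Q + card (insert x (set ys))"
        unfolding cW by simp
      also have "x \<notin> set ys" using ys(2) by auto
      then have "card (insert x (set ys)) = Suc (length ys)" using distinct_card[OF ys(1)] by simp
      finally have cardW: "card W = card Q + Suc (length ys)" .
      have "card Q + length (run t w) \<le> g * card P" if P: "solves w P" for P
      proof -
        have finP: "finite P" using solves_finite P by blast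
        have "card Q + length (run t w) = card W + length (run (f p') w)" using cardW r by simp
        \<comment> \<open>The part of \<open>P\<close> inside \<open>W\<close> pays for
          \<open>W\<close> with factor \<open>g\<close>, and the part outside pays for the remaining
          queries with factor \<open>2 \<le> g\<close>.\<close>
        also have "\<dots> \<le> g * card (P \<inter> W) + 2 * card (P - W)"
          using fp P W(3) w unfolding hit_dense_def by (intro add_mono) auto
        also have "\<dots> \<le> g * card (P \<inter> W) + g * card (P - W)" using g by simp
        also have "\<dots> = g * card ((P \<inter> W) \<union> (P - W))"
          using finP by (subst card_Un_disjoint) (auto simp: distrib_left)
        also have "(P \<inter> W) \<union> (P - W) = P" by blast
        finally show ?thesis .
      qed
      moreover have "distinct (run t w)" using fp ys x W unfolding r by auto
      moreover have "set (run t w) \<subseteq> E - Q" using fp ys x W unfolding r by auto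
      moreover have "Q \<union> set (run t w) = W \<union> set (run (f p') w)"
        using cW unfolding r by auto
      ultimately show ?thesis using fp False x by auto
    qed
  qed
qed

lemma consistent_robust_tree:
  assumes p: "realization l u p" and g: "2 \<le> g"
  shows "\<exists>t. \<forall>w. realization l u w \<longrightarrow> distinct (run t w) \<and> set (run t w) \<subseteq> E \<and>
    solves w (set (run t w)) \<and> (\<forall>P. solves w P \<longrightarrow> length (run t w) \<le> g * card P) \<and>
    ((\<forall>e \<in> E. w e = p e) \<longrightarrow> (\<forall>P. solves w P \<longrightarrow> g * length (run t w) \<le> Suc g * card P))"
proof -
  obtain xs where xs: "trusted_plan g p {} xs"
    "\<And>P. solves p P \<Longrightarrow> g * length xs \<le> Suc g * card P"
    using ex_trusted_plan[OF p g, of "{}" "{}"] invariant_init by auto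
  from trusted_plan_tree[OF p g empty_subsetI xs(1)]
  obtain t where t: "\<forall>w. compat p {} w \<longrightarrow> distinct (run t w) \<and> set (run t w) \<subseteq> E - {} \<and>
    solves w ({} \<union> set (run t w)) \<and>
    (\<forall>P. solves w P \<longrightarrow> card ({} :: 'e set) + length (run t w) \<le> g * card P) \<and>
    ((\<forall>e \<in> E. w e = p e) \<longrightarrow> run t w = xs)"
    by (elim exE)
  show ?thesis
  proof (intro exI[of _ t] allI impI)
    fix w assume "realization l u w"
    then have "compat p {} w" by (simp add: compat_def)
    note t = t[THEN spec, THEN mp, OF this]
    have "solves p P" if "\<forall>e \<in> E. w e = p e" "solves w P" for P
      using that feas_cong[of P w p l u] feas_sub[OF that(2)] by blast
    then show "distinct (run t w) \<and> set (run t w) \<subseteq> E \<and> solves w (set (run t w)) \<and>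
      (\<forall>P. solves w P \<longrightarrow> length (run t w) \<le> g * card P) \<and>
      ((\<forall>e \<in> E. w e = p e) \<longrightarrow> (\<forall>P. solves w P \<longrightarrow> g * length (run t w) \<le> Suc g * card P))"
      using t xs(2) by auto
  qed
qed

end

subsection \<open>Mixing two integer parameters\<close>

definition lower :: "('v, 'e) mst_input \<Rightarrow> 'e \<Rightarrow> real" where
  "lower X e = Inf (uncertainty X e)"

definition upper :: "('v, 'e) mst_input \<Rightarrow> 'e \<Rightarrow> real" where
  "upper X e = Sup (uncertainty X e)"

lemma uncertainty_iff_in_range:
  assumes "mst_instance X w" "e \<in> edges (graph X)"
  shows "x \<in> uncertainty X e \<longleftrightarrow> in_range (lower X e) (upper X e) x"
    and "lower X e \<le> upper X e"
proof -
  have w: "w e \<in> uncertainty X e"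
    "uncertainty X e = {w e} \<or> (\<exists>L U. uncertainty X e = {L<..<U})"
    using assms by (auto simp: mst_instance_def)
  from w(2) have "(x \<in> uncertainty X e \<longleftrightarrow> in_range (lower X e) (upper X e) x) \<and> lower X e \<le> upper X e"
  proof
    assume I: "uncertainty X e = {w e}"
    then have "lower X e = w e" "upper X e = w e" by (simp_all add: lower_def upper_def)
    then show ?thesis by (auto simp: I in_range_def)
  next
    assume "\<exists>L U. uncertainty X e = {L<..<U}"
    then obtain L U where I: "uncertainty X e = {L<..<U}" by blast
    then have "L < U" using w(1) by auto
    then have "lower X e = L" "upper X e = U" by (simp_all add: lower_def upper_def I)
    then show ?thesis using \<open>L < U\<close> by (auto simp: I in_range_def)
  qed
  then show "x \<in> uncertainty X e \<longleftrightarrow> in_range (lower X e) (upper X e) x" "lower X e \<le> upper X e"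
    by auto
qed

lemma mst_instance_uncertain_system:
  assumes "mst_instance X w"
  shows "uncertain_system (edges (graph X)) {T. spanning_tree (graph X) T} (lower X) (upper X)"
proof
  have G: "multigraph (graph X)" "connects (graph X) (edges (graph X))"
    using assms by (auto simp: mst_instance_def)
  show "finite (edges (graph X))" using G by (simp add: multigraph_def)
  show "{T. spanning_tree (graph X) T} \<noteq> {}" using ex_spanning_tree[OF G] by blast
  show "T \<subseteq> edges (graph X)" if "T \<in> {T. spanning_tree (graph X) T}" for T
    using that by (simp add: spanning_tree_def)
  show "\<exists>g \<in> T - S. insert g (S - {e}) \<in> {T. spanning_tree (graph X) T} \<and>
      insert e (T - {g}) \<in> {T. spanning_tree (graph X) T}"
    if "S \<in> {T. spanning_tree (graph X) T}" "T \<in> {T. spanning_tree (graph X) T}" "e \<in> S - T" for S T e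
    using spanning_tree_symmetric_exchange[OF G(1)] that by blast
  show "lower X e \<le> upper X e" if "e \<in> edges (graph X)" for e
    using uncertainty_iff_in_range(2)[OF assms that] .
qed

text \<open>One strategy for \<open>X\<close> has to serve all weights \<open>w\<close>. Comparing
  with every feasible \<open>P\<close> postpones the minimum cardinality to the end.\<close>

definition tradeoff :: "nat \<Rightarrow> ('v, 'e) mst_input \<Rightarrow> 'e strategy \<Rightarrow> bool" where
  "tradeoff g X s \<longleftrightarrow> (\<forall>w. mst_instance X w \<longrightarrow> feasible_query_set X w (queries X w s) \<and>
    (\<forall>P. feasible_query_set X w P \<longrightarrow> card (queries X w s) \<le> g * card P \<and>
      ((\<forall>e \<in> edges (graph X). prediction X e = w e) \<longrightarrow>
        g * card (queries X w s) \<le> Suc g * card P)))"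

lemma ex_tradeoff:
  assumes g: "2 \<le> g"
  shows "\<exists>s. tradeoff g X s"
proof (cases "\<exists>w. mst_instance X w")
  case True
  \<comment> \<open>\<open>w0\<close> only certifies that \<open>X\<close> is a legitimate input;
    limits and predictions depend on \<open>X\<close> alone.\<close>
  then obtain w0 where w0: "mst_instance X w0" by blast
  let ?E = "edges (graph X)"
  interpret uncertain_system ?E "{T. spanning_tree (graph X) T}" "lower X" "upper X"
    using w0 by (rule mst_instance_uncertain_system)
  note range = uncertainty_iff_in_range(1)[OF w0]
  have opt_iff: "opt w T \<longleftrightarrow> minimum_spanning_tree (graph X) w T" for w T
    by (simp add: opt_def minimum_spanning_tree_def)
  have feas_iff: "feasible_query_set X w P \<longleftrightarrow> solves w P" for w P
    unfolding feasible_query_set_def feas_def opt_iff by (auto simp: range)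
  have real: "realization (lower X) (upper X) w" if "mst_instance X w" for w
    using that range by (auto simp: realization_def mst_instance_def)
  have "realization (lower X) (upper X) (prediction X)"
    using w0 range by (auto simp: realization_def mst_instance_def)
  from consistent_robust_tree[OF this g] obtain t where t:
    "\<And>w. realization (lower X) (upper X) w \<Longrightarrow> distinct (run t w) \<and> set (run t w) \<subseteq> ?E \<and>
      solves w (set (run t w)) \<and> (\<forall>P. solves w P \<longrightarrow> length (run t w) \<le> g * card P) \<and>
      ((\<forall>e \<in> ?E. w e = prediction X e) \<longrightarrow>
        (\<forall>P. solves w P \<longrightarrow> g * length (run t w) \<le> Suc g * card P))" by blast
  show ?thesis unfolding tradeoff_def
  proof (intro exI[of _ "strategy_of t"] allI impI)
    fix w assume w: "mst_instance X w"
    note t = t[OF real[OF w]]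
    have "queries X w (strategy_of t) = set (run t w)"
      using t finite_E by (intro queries_strategy_of) auto
    moreover have "card (set (run t w)) = length (run t w)" using t by (simp add: distinct_card)
    ultimately show "feasible_query_set X w (queries X w (strategy_of t)) \<and>
      (\<forall>P. feasible_query_set X w P \<longrightarrow> card (queries X w (strategy_of t)) \<le> g * card P \<and>
        ((\<forall>e \<in> ?E. prediction X e = w e) \<longrightarrow>
          g * card (queries X w (strategy_of t)) \<le> Suc g * card P))"
      using t unfolding feas_iff by auto
  qed
qed (auto simp: tradeoff_def)

lemma opt_card_attained:
  assumes "feasible_query_set X w Q"
  shows "\<exists>P. feasible_query_set X w P \<and> card P = opt_card X w"
  unfolding opt_card_def by (rule LeastI_ex) (use assms in blast)

text \<open>
  The excess over \<open>1 + 1 / (k + \<theta>)\<close> is \<open>\<theta> (1 - \<theta>) / (k (k + 1) (k + \<theta>)) \<le> 1/48\<close>.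
\<close>

lemma mixture_consistency:
  fixes k \<theta> :: real
  assumes "2 \<le> k" "0 \<le> \<theta>" "\<theta> \<le> 1"
  shows "\<theta> * ((k + 2) / (k + 1)) + (1 - \<theta>) * ((k + 1) / k) \<le> 1.021 + 1 / (k + \<theta>)"
proof -
  have pos: "0 < k" "0 < k + 1" "0 < k + \<theta>" using assms by auto
  have "\<theta> * ((k + 2) / (k + 1)) + (1 - \<theta>) * ((k + 1) / k) - 1 - 1 / (k + \<theta>)
      = \<theta> * (1 - \<theta>) / (k * (k + 1) * (k + \<theta>))"
    using pos by (simp add: divide_simps) algebra
  \<comment> \<open>The product \<open>\<theta> * (1 - \<theta>)\<close> is largest at
    \<open>\<theta> = 1 / 2\<close>, and the denominator is at least
    \<open>2 * 3 * 2\<close>.\<close>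
  also have "\<dots> \<le> (1 / 4) / 12"
  proof (rule frac_le)
    have "0 \<le> (\<theta> - 1 / 2)\<^sup>2" by simp
    then show "\<theta> * (1 - \<theta>) \<le> 1 / 4" by (simp add: power2_eq_square algebra_simps)
    have "2 * 3 \<le> k * (k + 1)" using assms by (intro mult_mono) auto
    then have "6 * 2 \<le> k * (k + 1) * (k + \<theta>)" using assms by (intro mult_mono) auto
    then show "12 \<le> k * (k + 1) * (k + \<theta>)" by simp
  qed (use assms in auto)
  finally show ?thesis by simp
qed

theorem theoremF2:
  fixes \<gamma> :: real
  assumes "\<gamma> \<in> \<rat>" and "\<gamma> \<ge> 2"
  shows "\<exists>A :: ('v, 'e) algorithm.
    solves_mst A \<and> consistent (1.021 + 1 / \<gamma>) A \<and> robust \<gamma> A"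
proof -
  have "\<forall>g X. \<exists>s. 2 \<le> g \<longrightarrow> tradeoff g (X :: ('v, 'e) mst_input) s"
    using ex_tradeoff by blast
  then obtain S where S: "\<And>g (X :: ('v, 'e) mst_input). 2 \<le> g \<Longrightarrow> tradeoff g X (S g X)"
    by metis
  define k where "k = nat \<lfloor>\<gamma>\<rfloor>"
  define \<theta> where "\<theta> = \<gamma> - real k"
  have k: "2 \<le> k" "0 \<le> \<theta>" "\<theta> \<le> 1" and \<gamma>: "\<gamma> = real k + \<theta>"
    using assms(2) unfolding k_def \<theta>_def by linarith+
  \<comment> \<open>The coin picks \<open>k + 1\<close> with probability \<open>\<theta>\<close>, so
    the expected robustness factor is
    \<open>\<theta> * (k + 1) + (1 - \<theta>) * k = \<gamma>\<close>.\<close>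
  define A :: "('v, 'e) algorithm" where
    "A X = map_pmf (\<lambda>b. S (if b then Suc k else k) X) (bernoulli_pmf \<theta>)" for X
  have feas: "feasible_query_set X w (queries X w (S g X))" if "mst_instance X w" "2 \<le> g" for X w g
    using S[OF that(2), of X] that(1) by (simp add: tradeoff_def)
  have "solves_mst A" using feas k by (auto simp: solves_mst_def A_def)
  moreover have expect: "expected_queries A X w =
    \<theta> * real (card (queries X w (S (Suc k) X))) + (1 - \<theta>) * real (card (queries X w (S k X)))" for X w
    using k by (simp add: expected_queries_def A_def)
  have bound: "card (queries X w (S g X)) \<le> g * opt_card X w"
    "(\<forall>e \<in> edges (graph X). prediction X e = w e) \<Longrightarrow>
      g * card (queries X w (S g X)) \<le> Suc g * opt_card X w" if w: "mst_instance X w" "2 \<le> g" for X w g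
  proof -
    obtain P where "feasible_query_set X w P" "card P = opt_card X w"
      using opt_card_attained[OF feas[OF w]] by blast
    then show "card (queries X w (S g X)) \<le> g * opt_card X w"
      "(\<forall>e \<in> edges (graph X). prediction X e = w e) \<Longrightarrow>
        g * card (queries X w (S g X)) \<le> Suc g * opt_card X w"
      using S[OF w(2), of X] w(1) unfolding tradeoff_def by metis+
  qed
  have "consistent (1.021 + 1 / \<gamma>) A"
    unfolding consistent_def
  proof (intro allI impI)
    fix X :: "('v, 'e) mst_input" and w
    assume w: "mst_instance X w \<and> (\<forall>e \<in> edges (graph X). prediction X e = w e)"
    have c: "real (card (queries X w (S g X))) \<le> (real g + 1) / real g * real (opt_card X w)"
      if "2 \<le> g" for g
    proof -
      have "g * card (queries X w (S g X)) \<le> Suc g * opt_card X w" using bound(2) w that by blast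
      then have "real (g * card (queries X w (S g X))) \<le> real (Suc g * opt_card X w)"
        by (simp only: of_nat_le_iff)
      then show ?thesis using that by (simp add: field_simps)
    qed
    have "expected_queries A X w \<le>
      \<theta> * ((real (Suc k) + 1) / real (Suc k) * real (opt_card X w)) +
        (1 - \<theta>) * ((real k + 1) / real k * real (opt_card X w))"
      unfolding expect using k c[of k] c[of "Suc k"] by (intro add_mono mult_left_mono) auto
    also have "\<dots> = (\<theta> * ((real k + 2) / (real k + 1)) + (1 - \<theta>) * ((real k + 1) / real k)) *
        real (opt_card X w)"
      by (simp add: algebra_simps)
    also have "\<dots> \<le> (1.021 + 1 / \<gamma>) * real (opt_card X w)"
      unfolding \<gamma> using k by (intro mult_right_mono mixture_consistency) auto
    finally show "expected_queries A X w \<le> (1.021 + 1 / \<gamma>) * real (opt_card X w)" .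
  qed
  moreover have "robust \<gamma> A"
    unfolding robust_def
  proof (intro allI impI)
    fix X :: "('v, 'e) mst_input" and w
    assume w: "mst_instance X w"
    have c: "real (card (queries X w (S g X))) \<le> real g * real (opt_card X w)" if "2 \<le> g" for g
      using bound(1)[OF w that] by (metis of_nat_le_iff of_nat_mult)
    have "expected_queries A X w \<le> \<theta> * (real (Suc k) * real (opt_card X w)) +
        (1 - \<theta>) * (real k * real (opt_card X w))"
      unfolding expect using k c[of k] c[of "Suc k"] by (intro add_mono mult_left_mono) auto
    also have "\<dots> = \<gamma> * real (opt_card X w)" by (simp add: \<gamma> algebra_simps)
    finally show "expected_queries A X w \<le> \<gamma> * real (opt_card X w)" .
  qed
  ultimately show ?thesis by blast
qed

end
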